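(* (1) For any $\lambda\in[0,1)$: $\omega\text{-}\mathrm{RL}\not\subseteq\mathbb{L}^{>\lambda}(\mathrm{QBA}|\mathrm{ND})$. (2) For any $\lambda\in[0,1)$: $\omega\text{-}\mathrm{CFL}\setminus\omega\text{-}\mathrm{RL}\not\subseteq\mathbb{L}^{>\lambda}(\mathrm{QBA}|\mathrm{ND})$. (3) For any $\lambda\in(0,1)$: $\mathbb{L}^{>\lambda}(\mathrm{QBA}|\mathrm{ND})\not\subseteq\omega\text{-}\mathrm{RL}$. (4) $\mathbb{L}^{=1}(\mathrm{QBA}|\mathrm{ND})\not\subseteq\omega\text{-}\mathrm{RL}$. (5) $\mathbb{L}^{=1}(\mathrm{QBA}|\mathrm{ND})\not\subseteq\omega\text{-}\mathrm{CFL}$.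
   Context: A quantum automaton is a tuple $\mathcal{A}=(\mathcal{H},|s_0\rangle,\Sigma,\{U_\sigma:\sigma\in\Sigma\},F)$ where $\mathcal{H}$ is a finite-dimensional complex Hilbert space, $|s_0\rangle$ a unit vector, $\Sigma$ a finite alphabet, each $U_\sigma$ unitary, and $F$ a subspace. For $w=\sigma_1\sigma_2\cdots\in\Sigma^\omega$ the non-disturbing run is $|s_n\rangle=U_{\sigma_n}\cdots U_{\sigma_1}|s_0\rangle$, and $f^{\mathrm{ND}}_{\mathcal{A}}(w)=\sup_{|\psi\rangle}\sup_{\{n_i\}}\inf_{i\ge1}|\langle\psi|s_{n_i}\rangle|^2$ (sup over unit $|\psi\rangle\in F$ and strictly increasing sequences $0\le n_1<n_2<\cdots$). $\mathcal{L}^{>\lambda}(\mathcal{A}|\mathrm{ND})=\{w:f^{\mathrm{ND}}_{\mathcal{A}}(w)>\lambda\}$, $\mathcal{L}^{=1}(\mathcal{A}|\mathrm{ND})=\{w:f^{\mathrm{ND}}_{\mathcal{A}}(w)=1\}$; $\mathbb{L}^{>\lambda}(\mathrm{QBA}|\mathrm{ND})$ and $\mathbb{L}^{=1}(\mathrm{QBA}|\mathrm{ND})$ are the classes of all such languages over all quantum automata. $\omega\text{-}\mathrm{RL}$ (resp. $\omega\text{-}\mathrm{CFL}$), the $\omega$-regular (resp. $\omega$-context-free) languages, is the class of all $\omega$-languages of the form $\bigcup_{i=1}^n U_iV_i^\omega$ with $n\in\mathbb{N}$ and $U_i,V_i$ regular (resp. context-free) languages of finite words, where $V^\omega$ is the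 set of infinite concatenations of nonempty words from $V$. *)

theory Defs
  imports "Jordan_Normal_Form.Matrix" "Jordan_Normal_Form.Conjugate"
          "HOL-Library.Omega_Words_Fun"
begin

datatype 'a rexp = RZero | ROne | RAtom 'a | RPlus "'a rexp" "'a rexp"
  | RTimes "'a rexp" "'a rexp" | RStar "'a rexp"

fun rlang :: "'a rexp \<Rightarrow> 'a list set" where
  "rlang RZero = {}"
| "rlang ROne = {[]}"
| "rlang (RAtom a) = {[a]}"
| "rlang (RPlus r s) = rlang r \<union> rlang s"
| "rlang (RTimes r s) = {u @ v | u v. u \<in> rlang r \<and> v \<in> rlang s}"
| "rlang (RStar r) = {concat ws | ws. set ws \<subseteq> rlang r}"

fun ratoms :: "'a rexp \<Rightarrow> 'a set" where
  "ratoms RZero = {}"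
| "ratoms ROne = {}"
| "ratoms (RAtom a) = {a}"
| "ratoms (RPlus r s) = ratoms r \<union> ratoms s"
| "ratoms (RTimes r s) = ratoms r \<union> ratoms s"
| "ratoms (RStar r) = ratoms r"

definition regular_lang :: "nat set \<Rightarrow> nat list set \<Rightarrow> bool" where
  "regular_lang \<Sigma> L \<longleftrightarrow> (\<exists>r. ratoms r \<subseteq> \<Sigma> \<and> rlang r = L)"

text \<open>Context-free grammars: nonterminals are nats (Inl), terminals are letters (Inr);
  a production is a pair (A, \<alpha>).\<close>

type_synonym cfg_prod = "nat \<times> (nat + nat) list"

inductive cfg_step :: "cfg_prod set \<Rightarrow> (nat + nat) list \<Rightarrow> (nat + nat) list \<Rightarrow> bool"
  for P where
  "(A, \<alpha>) \<in> P \<Longrightarrow> cfg_step P (u @ [Inl A] @ v) (u @ \<alpha> @ v)"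

definition cfg_lang :: "cfg_prod set \<Rightarrow> nat \<Rightarrow> nat list set" where
  "cfg_lang P S = {w. (cfg_step P)\<^sup>*\<^sup>* [Inl S] (map Inr w)}"

definition context_free_lang :: "nat set \<Rightarrow> nat list set \<Rightarrow> bool" where
  "context_free_lang \<Sigma> L \<longleftrightarrow>
     (\<exists>P S. finite P \<and> (\<forall>(A, \<alpha>) \<in> P. \<forall>a. Inr a \<in> set \<alpha> \<longrightarrow> a \<in> \<Sigma>) \<and> cfg_lang P S = L)"

definition omega_words :: "nat set \<Rightarrow> nat word set" where
  "omega_words \<Sigma> = {w. \<forall>i. w i \<in> \<Sigma>}"

definition is_inf_concat :: "(nat \<Rightarrow> 'a list) \<Rightarrow> 'a word \<Rightarrow> bool" where
  "is_inf_concat f w \<longleftrightarrow>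
     (\<forall>n. prefix (sum_list (map (length \<circ> f) [0..<n])) w = concat (map f [0..<n]))"

definition omega_power :: "'a list set \<Rightarrow> 'a word set" where
  "omega_power V = {w. \<exists>f. (\<forall>i. f i \<in> V \<and> f i \<noteq> []) \<and> is_inf_concat f w}"

definition lang_conc :: "'a list set \<Rightarrow> 'a word set \<Rightarrow> 'a word set" where
  "lang_conc U W = {u \<frown> w | u w. u \<in> U \<and> w \<in> W}"

definition omega_RL :: "nat set \<Rightarrow> nat word set set" where
  "omega_RL \<Sigma> = {L. \<exists>(n::nat) U V. (\<forall>i<n. regular_lang \<Sigma> (U i) \<and> regular_lang \<Sigma> (V i))
                    \<and> L = (\<Union>i<n. lang_conc (U i) (omega_power (V i)))}"

definition omega_CFL :: "nat set \<Rightarrow> nat word set set" where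
  "omega_CFL \<Sigma> = {L. \<exists>(n::nat) U V. (\<forall>i<n. context_free_lang \<Sigma> (U i) \<and> context_free_lang \<Sigma> (V i))
                    \<and> L = (\<Union>i<n. lang_conc (U i) (omega_power (V i)))}"

definition braket :: "complex vec \<Rightarrow> complex vec \<Rightarrow> complex" where
  "braket \<psi> s = (\<Sum>i<dim_vec s. cnj (\<psi> $ i) * s $ i)"

definition unit_vec_c :: "nat \<Rightarrow> complex vec \<Rightarrow> bool" where
  "unit_vec_c d v \<longleftrightarrow> v \<in> carrier_vec d \<and> braket v v = 1"

definition adjoint_c :: "complex mat \<Rightarrow> complex mat" where
  "adjoint_c A = mat (dim_col A) (dim_row A) (\<lambda>(i, j). cnj (A $$ (j, i)))"

definition unitary_c :: "nat \<Rightarrow> complex mat \<Rightarrow> bool" where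
  "unitary_c d U \<longleftrightarrow> U \<in> carrier_mat d d \<and> adjoint_c U * U = 1\<^sub>m d"

definition subspace_c :: "nat \<Rightarrow> complex vec set \<Rightarrow> bool" where
  "subspace_c d F \<longleftrightarrow> F \<subseteq> carrier_vec d \<and> 0\<^sub>v d \<in> F \<and>
     (\<forall>x\<in>F. \<forall>y\<in>F. x + y \<in> F) \<and> (\<forall>c. \<forall>x\<in>F. c \<cdot>\<^sub>v x \<in> F)"

definition quantum_automaton ::
  "nat set \<Rightarrow> nat \<Rightarrow> complex vec \<Rightarrow> (nat \<Rightarrow> complex mat) \<Rightarrow> complex vec set \<Rightarrow> bool" where
  "quantum_automaton \<Sigma> d s0 U F \<longleftrightarrow> finite \<Sigma> \<and> unit_vec_c d s0 \<and>
     (\<forall>\<sigma>\<in>\<Sigma>. unitary_c d (U \<sigma>)) \<and> subspace_c d F"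

text \<open>Non-disturbing run: run 0 = s0, run (n+1) = U_{w n} run n
  (w 0 is the first letter \<sigma>_1).\<close>
fun qrun :: "complex vec \<Rightarrow> (nat \<Rightarrow> complex mat) \<Rightarrow> nat word \<Rightarrow> nat \<Rightarrow> complex vec" where
  "qrun s0 U w 0 = s0"
| "qrun s0 U w (Suc n) = U (w n) *\<^sub>v qrun s0 U w n"

text \<open>f^ND: sup over unit \<psi> \<in> F and strictly increasing index sequences of the inf over i.
  The value 0 is added to the set, so that the supremum over an empty range is 0
  (it does not change the supremum otherwise, since all values are \<ge> 0).\<close>
definition f_ND :: "nat \<Rightarrow> complex vec \<Rightarrow> (nat \<Rightarrow> complex mat) \<Rightarrow> complex vec set \<Rightarrow> nat word \<Rightarrow> real" where
  "f_ND d s0 U F w = Sup (insert 0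
     {(INF i::nat. (cmod (braket \<psi> (qrun s0 U w (n i))))\<^sup>2) | \<psi> n.
        \<psi> \<in> F \<and> unit_vec_c d \<psi> \<and> strict_mono n})"

definition QBA_ND_gt :: "nat set \<Rightarrow> real \<Rightarrow> nat word set set" where
  "QBA_ND_gt \<Sigma> lam = {L. \<exists>d s0 U F. quantum_automaton \<Sigma> d s0 U F \<and>
       L = {w \<in> omega_words \<Sigma>. f_ND d s0 U F w > lam}}"

definition QBA_ND_eq1 :: "nat set \<Rightarrow> nat word set set" where
  "QBA_ND_eq1 \<Sigma> = {L. \<exists>d s0 U F. quantum_automaton \<Sigma> d s0 U F \<and>
       L = {w \<in> omega_words \<Sigma>. f_ND d s0 U F w = 1}}"

end

theory Submission
  imports "HOL-Analysis.Kronecker_Approximation_Theorem" Defs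
begin

text \<open>
  Three observations carry the proof, all over the alphabet \<open>{0, 1}\<close>.

  Recurrence: for a unitary \<open>U\<close> some positive power \<open>U\<^sup>k\<close> moves the initial state by less than any
  given \<open>\<epsilon>\<close>. So a cut-point language containing \<open>w\<close> also contains \<open>1\<^sup>k w\<close> for some \<open>k > 0\<close>. This
  excludes \<open>{0\<^sup>\<omega>}\<close> and \<open>{0\<^sup>n 1\<^sup>n 0\<^sup>\<omega>}\<close>.

  Left quotients: an \<open>\<omega>\<close>-regular language has finitely many left quotients. The language
  \<open>{0\<^sup>n 1\<^sup>n 0\<^sup>\<omega>}\<close> has infinitely many, and so has the cut-point language of an irrational rotation:
  equal quotients by \<open>0\<^sup>m\<close> and \<open>0\<^sup>n\<close> would make acceptance of \<open>0\<^sup>k 1\<^sup>\<omega>\<close> constant along an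
  arithmetic progression of \<open>k\<close>, contradicting Kronecker's theorem.

  Ultimately periodic words: every nonempty union of sets \<open>U V\<^sup>\<omega>\<close> contains a word \<open>u v\<^sup>\<omega>\<close>,
  whatever \<open>U\<close> and \<open>V\<close> are. Let the letters 0 and 1 rotate the two coordinates of a torus by the same
  irrational angle, and let \<open>F\<close> be the line of a point \<open>(p\<^sub>1, p\<^sub>2)\<close> of the torus. The run on \<open>u v\<^sup>\<omega>\<close>
  accumulates only on finitely many proper closed cosets, and a generic point avoids all of these;
  but by density some word accumulates at the point.
\<close>

unbundle no vec_syntax

section \<open>Infinite words and left quotients\<close>

text \<open>The defining prefix condition for \<open>f\<close> at \<open>Suc n\<close> is the
  condition for the shifted sequence at \<open>n\<close>, and at 0 it is trivial. This lets single
  factors be peeled off or prepended.\<close>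

lemma is_inf_concat_conc:
  "is_inf_concat f (f 0 \<frown> w) \<longleftrightarrow> is_inf_concat (\<lambda>i. f (Suc i)) w"
proof -
  have *: "prefix (sum_list (map (length \<circ> f) [0..<Suc n])) (f 0 \<frown> w) = concat (map f [0..<Suc n])
    \<longleftrightarrow> prefix (sum_list (map (length \<circ> (\<lambda>i. f (Suc i))) [0..<n])) w
          = concat (map (\<lambda>i. f (Suc i)) [0..<n])" for n
    by (simp add: map_upt_Suc o_def del: upt_Suc)
  show ?thesis
    unfolding is_inf_concat_def
  proof safe
    fix n
    assume "\<forall>n. prefix (sum_list (map (length \<circ> f) [0..<n])) (f 0 \<frown> w) = concat (map f [0..<n])"
    then show "prefix (sum_list (map (length \<circ> (\<lambda>i. f (Suc i))) [0..<n])) w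
          = concat (map (\<lambda>i. f (Suc i)) [0..<n])"
      using * by blast
  next
    fix n
    assume "\<forall>n. prefix (sum_list (map (length \<circ> (\<lambda>i. f (Suc i))) [0..<n])) w
          = concat (map (\<lambda>i. f (Suc i)) [0..<n])"
    then show "prefix (sum_list (map (length \<circ> f) [0..<n])) (f 0 \<frown> w) = concat (map f [0..<n])"
      using * by (cases n) auto
  qed
qed

text \<open>A nonempty \<open>v\<close> is prepended to the factor sequence with
  \<open>case_nat\<close>; an empty one leaves the word unchanged.\<close>

lemma omega_power_conc:
  assumes "v \<in> V" "x \<in> omega_power V"
  shows "v \<frown> x \<in> omega_power V"
proof (cases "v = []")
  case False
  from assms(2) obtain f where f: "\<forall>i. f i \<in> V \<and> f i \<noteq> []" "is_inf_concat f x"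
    unfolding omega_power_def by blast
  have "is_inf_concat (case_nat v f) (v \<frown> x)"
    using is_inf_concat_conc[of "case_nat v f" x] f(2) by simp
  moreover have "\<forall>i. case_nat v f i \<in> V \<and> case_nat v f i \<noteq> []"
    using f(1) assms(1) False by (auto split: nat.split)
  ultimately show ?thesis
    unfolding omega_power_def by blast
qed (use assms in simp)

lemma omega_power_concat:
  assumes "set vs \<subseteq> V" "x \<in> omega_power V"
  shows "concat vs \<frown> x \<in> omega_power V"
  using assms(1)
proof (induction vs)
  case (Cons v vs)
  then have "v \<frown> concat vs \<frown> x \<in> omega_power V"
    by (intro omega_power_conc[of v V "concat vs \<frown> x"]) auto
  then show ?case by simp
qed (use assms in simp)

lemma omega_powerE:
  assumes "x \<in> omega_power V"
  obtains v y where "v \<in> V" "v \<noteq> []" "y \<in> omega_power V" "x = v \<frown> y"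
proof -
  from assms obtain f where f: "\<forall>i. f i \<in> V \<and> f i \<noteq> []" "is_inf_concat f x"
    unfolding omega_power_def by blast
  have "prefix (length (f 0)) x = f 0"
    using f(2)[unfolded is_inf_concat_def, rule_format, of 1] by simp
  then have x: "x = f 0 \<frown> suffix (length (f 0)) x"
    by (metis prefix_suffix)
  have "is_inf_concat f (f 0 \<frown> suffix (length (f 0)) x)"
    using f(2) by (subst (asm) x)
  then have "is_inf_concat (\<lambda>i. f (Suc i)) (suffix (length (f 0)) x)"
    by (simp only: is_inf_concat_conc)
  then have "suffix (length (f 0)) x \<in> omega_power V"
    using f(1) unfolding omega_power_def by (auto intro!: exI[of _ "\<lambda>i. f (Suc i)"])
  with x f(1) that show thesis by blast
qed

lemma iter_in_omega_power:
  assumes "v \<in> V" "v \<noteq> []"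
  shows "v\<^sup>\<omega> \<in> omega_power V"
proof -
  have "prefix (sum_list (map (length \<circ> (\<lambda>_. v)) [0..<n])) (v\<^sup>\<omega>) = concat (map (\<lambda>_. v) [0..<n])" for n
  proof (induction n)
    case (Suc n)
    let ?k = "sum_list (map (length \<circ> (\<lambda>_. v)) [0..<n])"
    have "prefix (length v + ?k) (v\<^sup>\<omega>) = v @ prefix ?k (v\<^sup>\<omega>)"
      using assms(2) by (subst iter_unroll) auto
    then show ?case
      using Suc.IH by (simp add: map_upt_Suc o_def del: upt_Suc)
  qed simp
  then have "is_inf_concat (\<lambda>_. v) (v\<^sup>\<omega>)"
    unfolding is_inf_concat_def by blast
  then show ?thesis
    unfolding omega_power_def using assms by (auto intro!: exI[of _ "\<lambda>_. v"])
qed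

text \<open>Levi's lemma for infinite words: of two finite prefixes of the same word, one extends
  the other.\<close>

lemma conc_eq_conc_cases:
  assumes "u \<frown> x = v \<frown> y"
  obtains t where "v = u @ t" "x = t \<frown> y" | t where "u = v @ t" "y = t \<frown> x"
proof (cases "length u \<le> length v")
  case True
  have *: "(u \<frown> x) = take (length u) v \<frown> (drop (length u) v \<frown> y)"
    using assms by simp
  have "u = take (length u) v \<and> x = drop (length u) v \<frown> y"
    using * True by (subst (asm) concat_eq) auto
  then show ?thesis using that(1) by (metis append_take_drop_id)
next
  case False
  have *: "(v \<frown> y) = take (length v) u \<frown> (drop (length v) u \<frown> x)"
    using assms by simp
  have "v = take (length v) u \<and> y = drop (length v) u \<frown> x"
    using * False by (subst (asm) concat_eq) auto
  then show ?thesis using that(2) by (metis append_take_drop_id)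
qed

section \<open>Left quotients of regular and omega-regular languages\<close>

definition word_quot :: "'a list \<Rightarrow> 'a list set \<Rightarrow> 'a list set" where
  "word_quot u K = {v. u @ v \<in> K}"

definition omega_quot :: "'a list \<Rightarrow> 'a word set \<Rightarrow> 'a word set" where
  "omega_quot u L = {w. u \<frown> w \<in> L}"

definition word_conc :: "'a list set \<Rightarrow> 'a list set \<Rightarrow> 'a list set" where
  "word_conc A B = {u @ v | u v. u \<in> A \<and> v \<in> B}"

text \<open>Product rule for derivatives: the boundary between the two factors lies either at or
  beyond the end of \<open>u\<close>, or inside \<open>u\<close>.\<close>

lemma word_quot_conc:
  "word_quot u (word_conc A B) =
     word_conc (word_quot u A) B \<union> \<Union> {word_quot u2 B | u1 u2. u = u1 @ u2 \<and> u1 \<in> A}"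
    (is "?l = ?r")
proof
  show "?l \<subseteq> ?r"
  proof
    fix v assume "v \<in> ?l"
    then obtain a b where ab: "u @ v = a @ b" "a \<in> A" "b \<in> B"
      by (auto simp: word_quot_def word_conc_def)
    from ab(1) consider t where "u @ t = a" "v = t @ b" | t where "u = a @ t" "t @ v = b"
      by (auto simp: append_eq_append_conv2)
    then show "v \<in> ?r"
    proof cases
      case 1
      then show ?thesis
        using ab(2,3) by (auto simp: word_quot_def word_conc_def)
    next
      case (2 t)
      then have "v \<in> word_quot t B"
        using ab(3) by (simp add: word_quot_def)
      then show ?thesis
        using 2 ab(2) by blast
    qed
  qed
  show "?r \<subseteq> ?l"
    unfolding word_quot_def word_conc_def by (auto 0 3 simp flip: append_assoc) (metis append_assoc)
qed

text \<open>The end of a nonempty \<open>u\<close> falls into one of the factors; those before it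
  are read completely and those after it stay free. For \<open>u = []\<close> the right side would
  lose the empty word whenever \<open>A\<close> does not contain it.\<close>

lemma word_quot_star:
  assumes "u \<noteq> []"
  shows "word_quot u {concat ws | ws. set ws \<subseteq> A} =
     \<Union> {word_conc (word_quot u2 A) {concat ws | ws. set ws \<subseteq> A} | u1 u2. u = concat u1 @ u2 \<and> set u1 \<subseteq> A}"
    (is "?l = ?r")
proof
  show "?l \<subseteq> ?r"
  proof
    fix v assume "v \<in> ?l"
    then obtain ws where ws: "concat ws = u @ v" "set ws \<subseteq> A"
      by (auto simp: word_quot_def)
    then have "ws \<noteq> []" using assms by auto
    from concat_eq_appendD[OF ws(1) this] obtain ws1 xs xs' ws2 where
      *: "ws = ws1 @ (xs @ xs') # ws2" "u = concat ws1 @ xs" "v = xs' @ concat ws2"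
      by blast
    then have "xs' \<in> word_quot xs A" "set ws2 \<subseteq> A" "set ws1 \<subseteq> A"
      using ws(2) by (auto simp: word_quot_def)
    then show "v \<in> ?r"
      using * unfolding word_conc_def by blast
  qed
  show "?r \<subseteq> ?l"
  proof
    fix v assume "v \<in> ?r"
    then obtain ws1 xs xs' ws2 where
      *: "u = concat ws1 @ xs" "set ws1 \<subseteq> A" "xs @ xs' \<in> A" "v = xs' @ concat ws2" "set ws2 \<subseteq> A"
      by (auto simp: word_quot_def word_conc_def)
    have "u @ v = concat (ws1 @ (xs @ xs') # ws2)" "set (ws1 @ (xs @ xs') # ws2) \<subseteq> A"
      using * by auto
    then show "v \<in> ?l"
      unfolding word_quot_def by blast
  qed
qed

text \<open>The easy half of Myhill-Nerode, by induction on the expression: a quotient of a compound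
  is determined by quotients, or sets of quotients, of its parts, and finitely many quotients have
  finitely many subsets.\<close>

lemma finite_word_quots_rlang: "finite (range (\<lambda>u. word_quot u (rlang r)))"
proof (induction r)
  case RZero
  show ?case by (simp add: word_quot_def)
next
  case ROne
  have "range (\<lambda>u. word_quot u (rlang ROne)) \<subseteq> {{}, {[]}}"
    by (auto simp: word_quot_def)
  then show ?case by (rule finite_subset) simp
next
  case (RAtom a)
  have "range (\<lambda>u. word_quot u (rlang (RAtom a))) \<subseteq> {{}, {[]}, {[a]}}"
    by (auto simp: word_quot_def append_eq_Cons_conv)
  then show ?case by (rule finite_subset) simp
next
  case (RPlus r s)
  have "range (\<lambda>u. word_quot u (rlang (RPlus r s))) \<subseteq>
    (\<lambda>(A, B). A \<union> B) ` (range (\<lambda>u. word_quot u (rlang r)) \<times> range (\<lambda>u. word_quot u (rlang s)))"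
    (is "_ \<subseteq> ?R")
  proof (rule image_subsetI)
    fix u
    have "word_quot u (rlang (RPlus r s)) = word_quot u (rlang r) \<union> word_quot u (rlang s)"
      by (auto simp: word_quot_def)
    then show "word_quot u (rlang (RPlus r s)) \<in> ?R"
      by (intro image_eqI[where x = "(word_quot u (rlang r), word_quot u (rlang s))"]) auto
  qed
  then show ?case by (rule finite_subset) (use RPlus.IH in simp)
next
  case (RTimes r s)
  have "range (\<lambda>u. word_quot u (rlang (RTimes r s))) \<subseteq>
    (\<lambda>(A, \<B>). word_conc A (rlang s) \<union> \<Union> \<B>) `
      (range (\<lambda>u. word_quot u (rlang r)) \<times> Pow (range (\<lambda>u. word_quot u (rlang s))))"
  proof safe
    fix u
    have "rlang (RTimes r s) = word_conc (rlang r) (rlang s)"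
      by (simp add: word_conc_def)
    then show "word_quot u (rlang (RTimes r s)) \<in> (\<lambda>(A, \<B>). word_conc A (rlang s) \<union> \<Union> \<B>) `
      (range (\<lambda>u. word_quot u (rlang r)) \<times> Pow (range (\<lambda>u. word_quot u (rlang s))))"
      by (intro image_eqI[where x = "(word_quot u (rlang r),
            {word_quot u2 (rlang s) | u1 u2. u = u1 @ u2 \<and> u1 \<in> rlang r})"])
         (auto simp: word_quot_conc)
  qed
  then show ?case by (rule finite_subset) (use RTimes.IH in simp)
next
  case (RStar r)
  let ?S = "rlang (RStar r)"
  \<comment> \<open>The extra element \<open>?S\<close> is the quotient by the empty word, which
    \<open>word_quot_star\<close> does not cover.\<close>
  have "range (\<lambda>u. word_quot u ?S) \<subseteq>
    insert ?S ((\<lambda>\<B>. \<Union> ((\<lambda>B. word_conc B ?S) ` \<B>)) ` Pow (range (\<lambda>u. word_quot u (rlang r))))"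
  proof (intro image_subsetI insertCI)
    fix u
    assume *: "word_quot u ?S \<notin>
      (\<lambda>\<B>. \<Union> ((\<lambda>B. word_conc B ?S) ` \<B>)) ` Pow (range (\<lambda>u. word_quot u (rlang r)))"
    have "u = []"
    proof (rule ccontr)
      assume "u \<noteq> []"
      from word_quot_star[OF this, of "rlang r"]
      have "word_quot u ?S = (\<Union> ((\<lambda>B. word_conc B ?S) `
          {word_quot u2 (rlang r) | u1 u2. u = concat u1 @ u2 \<and> set u1 \<subseteq> rlang r}))"
        unfolding rlang.simps by (simp only:) blast
      moreover have "{word_quot u2 (rlang r) | u1 u2. u = concat u1 @ u2 \<and> set u1 \<subseteq> rlang r}
          \<in> Pow (range (\<lambda>u. word_quot u (rlang r)))"
        by blast
      ultimately show False using * by (metis (no_types, lifting) image_eqI)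
    qed
    then show "word_quot u ?S = ?S" by (simp add: word_quot_def)
  qed
  then show ?case by (rule finite_subset) (use RStar.IH in simp)
qed

text \<open>Factors are stripped from \<open>u\<close> one at a time until a factor reaches the end
  of \<open>u\<close>; that factor is then split as \<open>t @ v\<close>.\<close>

lemma conc_in_omega_powerE:
  assumes "u \<frown> w \<in> omega_power V"
  obtains vs t v x where "u = concat vs @ t" "set vs \<subseteq> V" "t @ v \<in> V" "w = v \<frown> x" "x \<in> omega_power V"
proof -
  have "\<exists>vs t v x. u = concat vs @ t \<and> set vs \<subseteq> V \<and> t @ v \<in> V \<and> w = v \<frown> x \<and> x \<in> omega_power V"
    using assms
  proof (induction u rule: length_induct)
    case (1 u)
    from 1(2) obtain v y where v: "v \<in> V" "v \<noteq> []" "y \<in> omega_power V" "u \<frown> w = v \<frown> y"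
      by (rule omega_powerE)
    from v(4) show ?case
    proof (cases rule: conc_eq_conc_cases)
      case (1 t)
      then have "u = concat [] @ u" "set [] \<subseteq> V" "u @ t \<in> V" using v by auto
      then show ?thesis using 1 v(3) by blast
    next
      case (2 t)
      then have "length t < length u" "t \<frown> w \<in> omega_power V" using v by auto
      with "1.IH" obtain vs t' v' x where
        *: "t = concat vs @ t'" "set vs \<subseteq> V" "t' @ v' \<in> V" "w = v' \<frown> x" "x \<in> omega_power V"
        by blast
      have "u = concat (v # vs) @ t'" "set (v # vs) \<subseteq> V"
        using * 2 v by auto
      then show ?thesis using *(3-5) by blast
    qed
  qed
  with that show thesis by blast
qed

text \<open>The end of \<open>u\<close> lies either in the head taken from \<open>U\<close> or in a
  later factor taken from \<open>V\<close>. Only quotients of \<open>U\<close> and \<open>V\<close>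
  occur on the right, which is what transfers finiteness from regular to omega-regular
  languages.\<close>

lemma omega_quot_lang_conc:
  "omega_quot u (lang_conc U (omega_power V)) =
     lang_conc (word_quot u U) (omega_power V) \<union>
     \<Union> {lang_conc (word_quot t V) (omega_power V) | a vs t. u = a @ concat vs @ t \<and> a \<in> U \<and> set vs \<subseteq> V}"
    (is "?l = ?r")
proof
  show "?l \<subseteq> ?r"
  proof
    fix w assume "w \<in> ?l"
    then obtain a x where a: "u \<frown> w = a \<frown> x" "a \<in> U" "x \<in> omega_power V"
      by (auto simp: omega_quot_def lang_conc_def)
    from a(1) show "w \<in> ?r"
    proof (cases rule: conc_eq_conc_cases)
      case (1 t)
      then show ?thesis using a(2,3) by (auto simp: word_quot_def lang_conc_def)
    next
      case (2 t)
      from 2 a(3) have "t \<frown> w \<in> omega_power V" by simp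
      then obtain vs t' v y where
        *: "t = concat vs @ t'" "set vs \<subseteq> V" "t' @ v \<in> V" "w = v \<frown> y" "y \<in> omega_power V"
        by (rule conc_in_omega_powerE)
      have "w \<in> lang_conc (word_quot t' V) (omega_power V)"
        using * by (auto simp: word_quot_def lang_conc_def)
      moreover have "u = a @ concat vs @ t'" using 2 * by simp
      ultimately show ?thesis using a(2) *(2) by blast
    qed
  qed
  show "?r \<subseteq> ?l"
  proof
    fix w assume "w \<in> ?r"
    then consider b x where "u @ b \<in> U" "x \<in> omega_power V" "w = b \<frown> x"
      | a vs t b x where "u = a @ concat vs @ t" "a \<in> U" "set vs \<subseteq> V" "t @ b \<in> V"
          "x \<in> omega_power V" "w = b \<frown> x"
      unfolding word_quot_def lang_conc_def by blast
    then show "w \<in> ?l"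
    proof cases
      case 1
      then show ?thesis by (auto simp: omega_quot_def lang_conc_def)
    next
      case 2
      have "concat (vs @ [t @ b]) \<frown> x \<in> omega_power V"
        using 2 by (intro omega_power_concat) auto
      moreover have "u \<frown> w = a \<frown> (concat (vs @ [t @ b]) \<frown> x)"
        using 2 by simp
      ultimately show ?thesis
        using 2(2) unfolding omega_quot_def lang_conc_def by blast
    qed
  qed
qed

theorem finite_omega_quots:
  assumes "L \<in> omega_RL \<Sigma>"
  shows "finite (range (\<lambda>u. omega_quot u L))"
proof -
  from assms obtain n :: nat and U V where *: "\<forall>i<n. regular_lang \<Sigma> (U i) \<and> regular_lang \<Sigma> (V i)"
    and L: "L = (\<Union>i<n. lang_conc (U i) (omega_power (V i)))"
    unfolding omega_RL_def mem_Collect_eq by (elim exE conjE)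
  have finq: "finite (range (\<lambda>u. word_quot u K))" if "regular_lang \<Sigma> K" for K
  proof -
    from that obtain r where "rlang r = K"
      unfolding regular_lang_def by blast
    then show ?thesis
      using finite_word_quots_rlang[of r] by simp
  qed
  have fin: "finite (range (\<lambda>u. omega_quot u (lang_conc (U i) (omega_power (V i)))))" if "i < n" for i
  proof -
    have "range (\<lambda>u. omega_quot u (lang_conc (U i) (omega_power (V i)))) \<subseteq>
      (\<lambda>(A, \<B>). lang_conc A (omega_power (V i)) \<union> \<Union> ((\<lambda>B. lang_conc B (omega_power (V i))) ` \<B>)) `
        (range (\<lambda>u. word_quot u (U i)) \<times> Pow (range (\<lambda>u. word_quot u (V i))))"
      (is "_ \<subseteq> ?R")
    proof (rule image_subsetI)
      fix u
      show "omega_quot u (lang_conc (U i) (omega_power (V i))) \<in> ?R"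
        by (intro image_eqI[where x = "(word_quot u (U i),
              {word_quot t (V i) | a vs t. u = a @ concat vs @ t \<and> a \<in> U i \<and> set vs \<subseteq> V i})"])
           (simp only: omega_quot_lang_conc prod.case, blast, blast)
    qed
    then show ?thesis
      by (rule finite_subset) (use finq * that in simp)
  qed
  have quot_L: "omega_quot u L = (\<Union>i<n. omega_quot u (lang_conc (U i) (omega_power (V i))))" for u
    by (auto simp: L omega_quot_def)
  \<comment> \<open>A quotient of the union is determined by the \<open>n\<close>-tuple of quotients
    of its members, an element of a finite product.\<close>
  have "range (\<lambda>u. omega_quot u L) \<subseteq>
      (\<lambda>f. \<Union>i<n. f i) ` (\<Pi>\<^sub>E i\<in>{..<n}. range (\<lambda>u. omega_quot u (lang_conc (U i) (omega_power (V i)))))"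
    (is "_ \<subseteq> ?R")
  proof (intro image_subsetI)
    fix u
    show "omega_quot u L \<in> ?R"
      by (rule image_eqI[where x = "\<lambda>i\<in>{..<n}. omega_quot u (lang_conc (U i) (omega_power (V i)))"])
         (simp_all add: quot_L)
  qed
  then show ?thesis
    by (rule finite_subset) (use fin in \<open>auto intro!: finite_PiE\<close>)
qed

text \<open>Take any word of the union, keep its head \<open>u\<close>, and repeat its first factor
  \<open>v\<close> forever.\<close>

lemma ultimately_periodic_in_union:
  fixes U V :: "nat \<Rightarrow> 'a list set"
  assumes L: "L = (\<Union>i<n. lang_conc (U i) (omega_power (V i)))" and "L \<noteq> {}"
  obtains u v where "v \<noteq> []" "u \<frown> v\<^sup>\<omega> \<in> L"
proof -
  from assms obtain i u x where *: "i < n" "u \<in> U i" "x \<in> omega_power (V i)"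
    by (auto simp: lang_conc_def)
  from *(3) obtain v where "v \<in> V i" "v \<noteq> []" by (rule omega_powerE)
  then have "u \<frown> v\<^sup>\<omega> \<in> L"
    using * iter_in_omega_power unfolding L lang_conc_def by blast
  with \<open>v \<noteq> []\<close> that show thesis by blast
qed

section \<open>Non-disturbing runs\<close>

text \<open>The Euclidean norm, written with \<open>L2_set\<close> so that the Cauchy-Schwarz
  inequality for \<open>L2_set\<close> applies to \<open>braket\<close>.\<close>

definition vnorm :: "complex vec \<Rightarrow> real" where
  "vnorm v = L2_set (\<lambda>i. cmod (v $ i)) {..<dim_vec v}"

lemma braket_self: "braket v v = complex_of_real ((vnorm v)\<^sup>2)"
proof -
  have "braket v v = (\<Sum>i<dim_vec v. complex_of_real ((cmod (v $ i))\<^sup>2))"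
    unfolding braket_def by (intro sum.cong refl) (metis complex_norm_square mult.commute)
  also have "\<dots> = complex_of_real ((vnorm v)\<^sup>2)"
    by (simp add: vnorm_def L2_set_def sum_nonneg)
  finally show ?thesis .
qed

lemma vnorm_nonneg: "vnorm v \<ge> 0"
  by (simp add: vnorm_def L2_set_nonneg)

lemma unit_vec_c_iff: "unit_vec_c d v \<longleftrightarrow> v \<in> carrier_vec d \<and> vnorm v = 1"
  unfolding unit_vec_c_def braket_self
  by (metis of_real_eq_1_iff one_power2 power2_eq_iff_nonneg vnorm_nonneg zero_le_one)

lemma norm_braket_le:
  assumes "dim_vec \<psi> = dim_vec s"
  shows "cmod (braket \<psi> s) \<le> vnorm \<psi> * vnorm s"
proof -
  have "cmod (braket \<psi> s) \<le> (\<Sum>i<dim_vec s. \<bar>cmod (\<psi> $ i)\<bar> * \<bar>cmod (s $ i)\<bar>)"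
    unfolding braket_def by (rule order_trans[OF norm_sum]) (simp add: norm_mult)
  also have "\<dots> \<le> vnorm \<psi> * vnorm s"
    unfolding vnorm_def assms by (rule L2_set_mult_ineq)
  finally show ?thesis .
qed

lemma braket_minus:
  assumes "s \<in> carrier_vec d" "t \<in> carrier_vec d"
  shows "braket \<psi> (s - t) = braket \<psi> s - braket \<psi> t"
  using assms by (simp add: braket_def sum_subtractf right_diff_distrib)

text \<open>The entries of \<open>adjoint_c U * U = 1\<close> say that the columns of
  \<open>U\<close> are orthonormal; exchanging the sums brings this relation into the inner
  product.\<close>

lemma braket_unitary:
  assumes "unitary_c d U" "x \<in> carrier_vec d" "y \<in> carrier_vec d"
  shows "braket (U *\<^sub>v x) (U *\<^sub>v y) = braket x y"
proof -
  have U: "U \<in> carrier_mat d d" and UU: "adjoint_c U * U = 1\<^sub>m d"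
    using assms(1) by (auto simp: unitary_c_def)
  have dims: "dim_row U = d" "dim_col U = d" "dim_vec x = d" "dim_vec y = d"
    using U assms by auto
  have delta: "(\<Sum>i<d. cnj (U $$ (i, j)) * U $$ (i, k)) = (if j = k then 1 else 0)"
    if "j < d" "k < d" for j k
  proof -
    have "(\<Sum>i<d. cnj (U $$ (i, j)) * U $$ (i, k)) = (adjoint_c U * U) $$ (j, k)"
      using that dims by (simp add: adjoint_c_def scalar_prod_def atLeast0LessThan)
    then show ?thesis using that by (simp add: UU)
  qed
  have "braket (U *\<^sub>v x) (U *\<^sub>v y) =
      (\<Sum>i<d. (\<Sum>j<d. cnj (U $$ (i, j)) * cnj (x $ j)) * (\<Sum>k<d. U $$ (i, k) * y $ k))"
    unfolding braket_def using dims by (intro sum.cong) (auto simp: scalar_prod_def atLeast0LessThan)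
  also have "\<dots> = (\<Sum>i<d. \<Sum>j<d. \<Sum>k<d. (cnj (x $ j) * y $ k) * (cnj (U $$ (i, j)) * U $$ (i, k)))"
    unfolding sum_product by (intro sum.cong refl) (simp add: mult_ac)
  also have "\<dots> = (\<Sum>j<d. \<Sum>i<d. \<Sum>k<d. (cnj (x $ j) * y $ k) * (cnj (U $$ (i, j)) * U $$ (i, k)))"
    by (rule sum.swap)
  also have "\<dots> = (\<Sum>j<d. \<Sum>k<d. \<Sum>i<d. (cnj (x $ j) * y $ k) * (cnj (U $$ (i, j)) * U $$ (i, k)))"
    by (intro sum.cong refl sum.swap)
  also have "\<dots> = (\<Sum>j<d. \<Sum>k<d. (cnj (x $ j) * y $ k) * (if j = k then 1 else 0))"
    by (intro sum.cong refl) (simp add: delta flip: sum_distrib_left)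
  also have "\<dots> = braket x y"
    by (simp add: braket_def dims if_distrib cong: if_cong)
  finally show ?thesis .
qed

lemma vnorm_unitary:
  assumes "unitary_c d U" "x \<in> carrier_vec d"
  shows "vnorm (U *\<^sub>v x) = vnorm x"
proof -
  have "(vnorm (U *\<^sub>v x))\<^sup>2 = (vnorm x)\<^sup>2"
    using braket_unitary[OF assms(1,2,2)] unfolding braket_self of_real_eq_iff .
  then show ?thesis by (simp add: vnorm_nonneg power2_eq_iff_nonneg)
qed

lemma qrun_carrier:
  assumes "\<forall>\<sigma>\<in>\<Sigma>. unitary_c d (U \<sigma>)" "w \<in> omega_words \<Sigma>" "s \<in> carrier_vec d"
  shows "qrun s U w n \<in> carrier_vec d"
  using assms(3)
proof (induction n)
  case (Suc n)
  have "U (w n) \<in> carrier_mat d d"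
    using assms(1,2) by (auto simp: omega_words_def unitary_c_def)
  then show ?case using Suc by simp
qed simp

text \<open>Both runs apply the same unitary matrices, so their difference is itself transported
  unitarily. Nearby initial states therefore stay equally near along every word.\<close>

lemma vnorm_qrun_diff:
  assumes "\<forall>\<sigma>\<in>\<Sigma>. unitary_c d (U \<sigma>)" "w \<in> omega_words \<Sigma>" "s \<in> carrier_vec d" "t \<in> carrier_vec d"
  shows "vnorm (qrun s U w n - qrun t U w n) = vnorm (s - t)"
proof (induction n)
  case (Suc n)
  have U: "unitary_c d (U (w n))" and C: "U (w n) \<in> carrier_mat d d"
    using assms by (auto simp: omega_words_def unitary_c_def)
  note c = qrun_carrier[OF assms(1,2,3), of n] qrun_carrier[OF assms(1,2,4), of n]
  have "qrun s U w (Suc n) - qrun t U w (Suc n) = U (w n) *\<^sub>v (qrun s U w n - qrun t U w n)"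
    using mult_minus_distrib_mat_vec[OF C c] by simp
  then show ?case
    using vnorm_unitary[OF U] c Suc.IH by simp
qed simp

lemma vnorm_qrun:
  assumes "\<forall>\<sigma>\<in>\<Sigma>. unitary_c d (U \<sigma>)" "w \<in> omega_words \<Sigma>" "s \<in> carrier_vec d"
  shows "vnorm (qrun s U w n) = vnorm s"
proof (induction n)
  case (Suc n)
  have "unitary_c d (U (w n))"
    using assms by (auto simp: omega_words_def)
  then show ?case
    using vnorm_unitary qrun_carrier[OF assms] Suc.IH by simp
qed simp

lemma qrun_conc: "qrun s U (u \<frown> w) (length u + n) = qrun (qrun s U (u \<frown> w) (length u)) U w n"
  by (induction n) simp_all

lemma qrun_cong: "(\<And>i. i < n \<Longrightarrow> w i = w' i) \<Longrightarrow> qrun s U w n = qrun s U w' n"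
  by (induction n) simp_all

section \<open>Bounds on the acceptance value\<close>

lemma braket_run_le_1:
  assumes "quantum_automaton \<Sigma> d s0 U F" "w \<in> omega_words \<Sigma>" "unit_vec_c d \<psi>"
  shows "(cmod (braket \<psi> (qrun s0 U w n)))\<^sup>2 \<le> 1"
proof -
  have *: "\<forall>\<sigma>\<in>\<Sigma>. unitary_c d (U \<sigma>)" "s0 \<in> carrier_vec d" "vnorm s0 = 1"
    using assms(1) by (auto simp: quantum_automaton_def unit_vec_c_iff)
  have "cmod (braket \<psi> (qrun s0 U w n)) \<le> vnorm \<psi> * vnorm (qrun s0 U w n)"
    using qrun_carrier[OF *(1) assms(2) *(2), of n] assms(3)
    by (intro norm_braket_le) (auto simp: unit_vec_c_iff)
  also have "\<dots> = 1"
    using vnorm_qrun[OF *(1) assms(2) *(2)] *(3) assms(3) by (simp add: unit_vec_c_iff)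
  finally show ?thesis by (simp add: power_le_one)
qed

text \<open>Suprema of real sets are usable only under boundedness; this is the bound behind both
  the upper and the lower estimates of \<open>f_ND\<close>.\<close>

lemma f_ND_set_bound:
  assumes "quantum_automaton \<Sigma> d s0 U F" "w \<in> omega_words \<Sigma>"
    and x: "x \<in> insert 0 {(INF i::nat. (cmod (braket \<psi> (qrun s0 U w (n i))))\<^sup>2) | \<psi> n.
        \<psi> \<in> F \<and> unit_vec_c d \<psi> \<and> strict_mono n}"
  shows "x \<le> 1"
proof -
  have "(INF i::nat. (cmod (braket \<psi> (qrun s0 U w (n i))))\<^sup>2) \<le> 1" 
    if "unit_vec_c d \<psi>" for \<psi> and n :: "nat \<Rightarrow> nat"
    by (rule cINF_lower2[where x = 0])
       (auto intro: braket_run_le_1[OF assms(1,2) that] bdd_belowI2[where m = 0])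
  then show ?thesis using x by auto
qed

lemma f_ND_le_1:
  assumes "quantum_automaton \<Sigma> d s0 U F" "w \<in> omega_words \<Sigma>"
  shows "f_ND d s0 U F w \<le> 1"
  unfolding f_ND_def by (rule cSup_least) (blast, rule f_ND_set_bound[OF assms])

lemma f_ND_ge:
  fixes n :: "nat \<Rightarrow> nat"
  assumes "quantum_automaton \<Sigma> d s0 U F" "w \<in> omega_words \<Sigma>"
    and "\<psi> \<in> F" "unit_vec_c d \<psi>" "strict_mono n"
    and "\<And>i. c \<le> (cmod (braket \<psi> (qrun s0 U w (n i))))\<^sup>2"
  shows "c \<le> f_ND d s0 U F w"
proof -
  have "c \<le> (INF i. (cmod (braket \<psi> (qrun s0 U w (n i))))\<^sup>2)"
    by (rule cINF_greatest) (auto intro: assms(6))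
  also have "\<dots> \<le> f_ND d s0 U F w"
    unfolding f_ND_def
    by (rule cSup_upper)
       (use assms(3-5) in blast, rule bdd_aboveI[where M = 1], rule f_ND_set_bound[OF assms(1,2)])
  finally show ?thesis .
qed

lemma f_ND_gtE:
  assumes "lam < f_ND d s0 U F w" "0 \<le> lam"
  obtains \<psi> and n :: "nat \<Rightarrow> nat" and c where "\<psi> \<in> F" "unit_vec_c d \<psi>" "strict_mono n" "lam < c"
    "\<And>i. c \<le> (cmod (braket \<psi> (qrun s0 U w (n i))))\<^sup>2"
proof -
  from assms(1) obtain x where x: "x \<in> insert 0 {(INF i::nat. (cmod (braket \<psi> (qrun s0 U w (n i))))\<^sup>2) | \<psi> n.
        \<psi> \<in> F \<and> unit_vec_c d \<psi> \<and> strict_mono n}" "lam < x"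
    unfolding f_ND_def by (rule less_cSupE) auto
  \<comment> \<open>The element above \<open>lam\<close> is not the inserted default 0, so it comes
    from an actual vector and index sequence.\<close>
  with assms(2) have "x \<noteq> 0" by simp
  with x(1) obtain \<psi> n where *: "\<psi> \<in> F" "unit_vec_c d \<psi>" "strict_mono n"
      "x = (INF i::nat. (cmod (braket \<psi> (qrun s0 U w (n i))))\<^sup>2)"
    by blast
  have "x \<le> (cmod (braket \<psi> (qrun s0 U w (n i))))\<^sup>2" for i
    unfolding *(4) by (rule cINF_lower) (auto intro: bdd_belowI2[where m = 0])
  with * x(2) that show thesis by blast
qed

section \<open>Recurrence\<close>

text \<open>Bolzano-Weierstrass applied to one coordinate after another, each time passing to a
  further subsequence.\<close>

lemma pointwise_convergent_subsequence:
  fixes f :: "nat \<Rightarrow> nat \<Rightarrow> complex"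
  assumes "\<And>k i. cmod (f k i) \<le> B"
  shows "\<exists>r. strict_mono (r :: nat \<Rightarrow> nat) \<and> (\<forall>i<d. convergent (\<lambda>k. f (r k) i))"
proof (induction d)
  case 0
  show ?case by (auto intro: strict_mono_id[unfolded id_def] exI[of _ "\<lambda>x. x"])
next
  case (Suc d)
  then obtain r where r: "strict_mono (r :: nat \<Rightarrow> nat)" "\<And>i. i < d \<Longrightarrow> convergent (\<lambda>k. f (r k) i)"
    by blast
  have "bounded (range (\<lambda>k. f (r k) d))"
    using assms by (auto intro!: boundedI)
  then obtain l q where q: "strict_mono (q :: nat \<Rightarrow> nat)" "((\<lambda>k. f (r k) d) \<circ> q) \<longlonglongrightarrow> l"
    using bounded_imp_convergent_subsequence by blast
  have "convergent (\<lambda>k. f ((r \<circ> q) k) i)" if "i < Suc d" for i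
  proof (cases "i = d")
    case True
    then show ?thesis using q(2) by (auto simp: convergent_def o_def)
  next
    case False
    then have "convergent (\<lambda>k. f (r k) i)" using that r(2) by simp
    from convergent_subseq_convergent[OF this q(1)] show ?thesis by (simp add: o_def)
  qed
  then show ?case using strict_mono_o[OF r(1) q(1)] by blast
qed

lemma norm_vec_index_le: "i < dim_vec v \<Longrightarrow> cmod (v $ i) \<le> vnorm v"
  unfolding vnorm_def by (rule member_le_L2_set) auto

lemma bounded_vec_sequence_close_pair:
  fixes x :: "nat \<Rightarrow> complex vec"
  assumes x: "\<And>k. x k \<in> carrier_vec d" "\<And>k. vnorm (x k) \<le> B" and "\<epsilon> > 0"
  obtains i j where "i < j" "vnorm (x j - x i) < \<epsilon>"
proof -
  \<comment> \<open>Padding with 0 beyond the dimension gives a bound that is uniform in all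
    indices.\<close>
  define f where "f = (\<lambda>k i. if i < d then x k $ i else 0)"
  have B: "0 \<le> B" using x(2)[of 0] vnorm_nonneg[of "x 0"] by linarith
  have "cmod (f k i) \<le> B" for k i
    using norm_vec_index_le[of i "x k"] x(1)[of k] x(2)[of k] B by (auto simp: f_def)
  then obtain r where r: "strict_mono (r :: nat \<Rightarrow> nat)" "\<And>i. i < d \<Longrightarrow> convergent (\<lambda>k. f (r k) i)"
    using pointwise_convergent_subsequence by metis
  \<comment> \<open>The norm is at most the sum of the \<open>d\<close> coordinate moduli, and
    \<open>d * \<delta> < \<epsilon>\<close> holds even for \<open>d = 0\<close> thanks to the added
    1.\<close>
  define \<delta> where "\<delta> = \<epsilon> / (real d + 1)"
  have \<delta>: "\<delta> > 0" using \<open>\<epsilon> > 0\<close> by (simp add: \<delta>_def)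
  have "\<exists>M. \<forall>m\<ge>M. \<forall>n\<ge>M. dist (f (r m) i) (f (r n) i) < \<delta>" if "i < d" for i
    using convergent_Cauchy[OF r(2)[OF that]] \<delta> unfolding Cauchy_def by blast
  then obtain M where M: "\<And>i m n. i < d \<Longrightarrow> m \<ge> M i \<Longrightarrow> n \<ge> M i \<Longrightarrow> dist (f (r m) i) (f (r n) i) < \<delta>"
    by metis
  define N where "N = Max (insert 0 (M ` {..<d}))"
  have N: "M i \<le> N" if "i < d" for i
    unfolding N_def using that by (intro Max_ge) auto
  have dim: "dim_vec (x (r (Suc N)) - x (r N)) = d"
    using x(1)[of "r N"] by simp
  have "vnorm (x (r (Suc N)) - x (r N)) \<le> (\<Sum>i<d. cmod ((x (r (Suc N)) - x (r N)) $ i))"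
    unfolding vnorm_def dim by (rule L2_set_le_sum) simp
  also have "\<dots> \<le> (\<Sum>i<d. \<delta>)"
  proof (rule sum_mono)
    fix i assume "i \<in> {..<d}"
    then have i: "i < d" by simp
    have "dist (f (r (Suc N)) i) (f (r N) i) < \<delta>"
      using M[OF i, of "Suc N" N] N[OF i] by simp
    then show "cmod ((x (r (Suc N)) - x (r N)) $ i) \<le> \<delta>"
      using i x(1)[of "r (Suc N)"] x(1)[of "r N"] by (simp add: f_def dist_norm)
  qed
  also have "\<dots> = real d * \<delta>" by simp
  also have "\<dots> < \<epsilon>" using \<open>\<epsilon> > 0\<close> by (simp add: \<delta>_def field_simps)
  finally have "vnorm (x (r (Suc N)) - x (r N)) < \<epsilon>" .
  moreover have "r N < r (Suc N)" using r(1) by (simp add: strict_mono_Suc_iff)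
  ultimately show thesis using that by blast
qed

text \<open>Compactness yields positions \<open>i < j\<close> of the run with close states.
  Unitarity cancels the first \<open>i\<close> steps, so the state after \<open>j - i\<close> steps
  is equally close to \<open>s\<close>.\<close>

lemma qrun_recurrence:
  assumes "unitary_c d (U b)" "s \<in> carrier_vec d" "\<epsilon> > 0"
  obtains k where "k > 0" "vnorm (qrun s U (\<lambda>_. b) k - s) < \<epsilon>"
proof -
  have *: "\<forall>\<sigma>\<in>{b}. unitary_c d (U \<sigma>)" "(\<lambda>_. b) \<in> omega_words {b}"
    using assms(1) by (auto simp: omega_words_def)
  let ?x = "qrun s U (\<lambda>_. b)"
  have "\<And>k. ?x k \<in> carrier_vec d" "\<And>k. vnorm (?x k) \<le> vnorm s"
    using qrun_carrier[OF * assms(2)] vnorm_qrun[OF * assms(2)] by auto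
  then obtain i j where ij: "i < j" "vnorm (?x j - ?x i) < \<epsilon>"
    using bounded_vec_sequence_close_pair[of ?x d "vnorm s" \<epsilon>] \<open>\<epsilon> > 0\<close> by blast
  have shift: "qrun s U (\<lambda>_. b) (m + n) = qrun (?x m) U (\<lambda>_. b) n" for m n
    by (induction n) simp_all
  have "?x j = qrun (?x (j - i)) U (\<lambda>_. b) i"
    using shift[of "j - i" i] ij(1) by simp
  then have "vnorm (?x (j - i) - s) = vnorm (?x j - ?x i)"
    using vnorm_qrun_diff[OF * qrun_carrier[OF * assms(2)] assms(2)] by simp
  with ij that[of "j - i"] show thesis by simp
qed

text \<open>After \<open>k\<close> suitable letters \<open>b\<close> the state is almost
  \<open>s0\<close> again. From there the run on \<open>w\<close> stays close to the original run,
  and the strict inequality at the cut point leaves room for the error.\<close>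

theorem QBA_ND_gt_prepend_power:
  assumes "L \<in> QBA_ND_gt \<Sigma> lam" "0 \<le> lam" "w \<in> L" "b \<in> \<Sigma>"
  obtains k where "k > 0" "replicate k b \<frown> w \<in> L"
proof -
  from assms(1) obtain d s0 U F where A: "quantum_automaton \<Sigma> d s0 U F"
    and L: "L = {w \<in> omega_words \<Sigma>. f_ND d s0 U F w > lam}"
    unfolding QBA_ND_gt_def by blast
  have U: "\<forall>\<sigma>\<in>\<Sigma>. unitary_c d (U \<sigma>)" and s0: "s0 \<in> carrier_vec d"
    using A by (auto simp: quantum_automaton_def unit_vec_c_def)
  have w: "w \<in> omega_words \<Sigma>" "lam < f_ND d s0 U F w"
    using assms(3) by (auto simp: L)
  obtain \<psi> and n :: "nat \<Rightarrow> nat" and c where \<psi>: "\<psi> \<in> F" "unit_vec_c d \<psi>" "strict_mono n" "lam < c"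
    "\<And>i. c \<le> (cmod (braket \<psi> (qrun s0 U w (n i))))\<^sup>2"
    using f_ND_gtE[OF w(2) assms(2)] by blast
  \<comment> \<open>Half the gap between the amplitudes: lowering \<open>sqrt c\<close> by
    \<open>\<epsilon>\<close> still leaves it above \<open>sqrt lam\<close>.\<close>
  define \<epsilon> where "\<epsilon> = (sqrt c - sqrt lam) / 2"
  have \<epsilon>: "\<epsilon> > 0" using \<psi>(4) by (simp add: \<epsilon>_def)
  obtain k where k: "k > 0" "vnorm (qrun s0 U (\<lambda>_. b) k - s0) < \<epsilon>"
    using qrun_recurrence[of d U b s0 \<epsilon>] U assms(4) s0 \<epsilon> by blast
  let ?w = "replicate k b \<frown> w"
  have w': "?w \<in> omega_words \<Sigma>"
    using w(1) assms(4) by (auto simp: omega_words_def conc_def)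
  let ?t = "qrun s0 U ?w k"
  have "?t = qrun s0 U (\<lambda>_. b) k"
    by (rule qrun_cong) simp
  with k(2) have t: "vnorm (?t - s0) < \<epsilon>" by simp
  have tc: "?t \<in> carrier_vec d" using qrun_carrier[OF U w' s0] .
  have "(sqrt c - \<epsilon>)\<^sup>2 \<le> f_ND d s0 U F ?w"
  proof (rule f_ND_ge[OF A w' \<psi>(1,2)])
    show "strict_mono (\<lambda>i. k + n i)" using \<psi>(3) by (simp add: strict_mono_def)
  next
    fix i
    let ?a = "qrun s0 U w (n i)" and ?b = "qrun s0 U ?w (k + n i)"
    have b: "?b = qrun ?t U w (n i)"
      using qrun_conc[of s0 U "replicate k b" w "n i"] by simp
    have c: "?a \<in> carrier_vec d" "?b \<in> carrier_vec d"
      using qrun_carrier[OF U _ s0] w w' by auto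
    have "cmod (braket \<psi> ?b - braket \<psi> ?a) = cmod (braket \<psi> (?b - ?a))"
      using braket_minus[OF c(2,1)] by simp
    also have "\<dots> \<le> vnorm \<psi> * vnorm (?b - ?a)"
      using \<psi>(2) c by (intro norm_braket_le) (simp add: unit_vec_c_iff carrier_vecD)
    also have "\<dots> = vnorm (?t - s0)"
      using \<psi>(2) vnorm_qrun_diff[OF U w(1) tc s0] by (simp add: unit_vec_c_iff b)
    finally have "cmod (braket \<psi> ?b - braket \<psi> ?a) < \<epsilon>" using t by simp
    moreover have "sqrt c \<le> cmod (braket \<psi> ?a)"
      using \<psi>(5)[of i] by (intro real_le_lsqrt) (use assms(2) \<psi>(4) in auto)
    ultimately have "sqrt c - \<epsilon> \<le> cmod (braket \<psi> ?b)"
      using norm_triangle_ineq2[of "braket \<psi> ?a" "braket \<psi> ?b"] by (simp add: norm_minus_commute)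
    moreover have "0 \<le> sqrt c - \<epsilon>"
      using assms(2) \<psi>(4) by (simp add: \<epsilon>_def field_simps add_nonneg_nonneg)
    ultimately show "(sqrt c - \<epsilon>)\<^sup>2 \<le> (cmod (braket \<psi> ?b))\<^sup>2"
      by (intro power_mono)
  qed
  moreover have "lam < (sqrt c - \<epsilon>)\<^sup>2"
  proof -
    have "sqrt lam < sqrt c - \<epsilon>" using \<psi>(4) by (simp add: \<epsilon>_def field_simps)
    then have "(sqrt lam)\<^sup>2 < (sqrt c - \<epsilon>)\<^sup>2" using assms(2) by (intro power_strict_mono) auto
    then show ?thesis using assms(2) by simp
  qed
  ultimately have "?w \<in> L" using w' by (simp add: L)
  with k(1) that show thesis by blast
qed

section \<open>Diagonal automata\<close>

text \<open>A point of the \<open>d\<close>-torus, with phases counted in full turns, is encoded as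
  a vector whose coordinates all have modulus \<open>1 / sqrt d\<close>. The matrices
  \<open>phase_mat\<close> then act as translations of the torus.\<close>

definition phase_vec :: "nat \<Rightarrow> (nat \<Rightarrow> real) \<Rightarrow> complex vec" where
  "phase_vec d p = vec d (\<lambda>j. cis (2 * pi * p j) / complex_of_real (sqrt (real d)))"

definition phase_mat :: "nat \<Rightarrow> (nat \<Rightarrow> real) \<Rightarrow> complex mat" where
  "phase_mat d x = mat d d (\<lambda>(i, j). if i = j then cis (2 * pi * x i) else 0)"

definition line_c :: "complex vec \<Rightarrow> complex vec set" where
  "line_c v = {c \<cdot>\<^sub>v v | c. True}"

lemma braket_phase_vec:
  assumes "d > 0"
  shows "braket (phase_vec d p) (phase_vec d q) = (\<Sum>j<d. cis (2 * pi * (q j - p j))) / of_nat d"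
proof -
  have sq: "complex_of_real (sqrt (real d)) * complex_of_real (sqrt (real d)) = of_nat d"
    by (simp flip: of_real_mult)
  have "cnj (cis (2 * pi * p j) / complex_of_real (sqrt (real d))) *
        (cis (2 * pi * q j) / complex_of_real (sqrt (real d))) = cis (2 * pi * (q j - p j)) / of_nat d" for j
    by (simp add: sq cis_cnj cis_mult algebra_simps)
  then show ?thesis
    by (simp add: braket_def phase_vec_def sum_divide_distrib)
qed

lemma unit_phase_vec: "d > 0 \<Longrightarrow> unit_vec_c d (phase_vec d p)"
  by (simp add: unit_vec_c_def braket_phase_vec) (simp add: phase_vec_def)

lemma unitary_phase_mat: "unitary_c d (phase_mat d x)"
proof -
  have "adjoint_c (phase_mat d x) * phase_mat d x = 1\<^sub>m d"
  proof (rule eq_matI)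
    fix i j assume "i < dim_row (1\<^sub>m d :: complex mat)" "j < dim_col (1\<^sub>m d :: complex mat)"
    then have ij: "i < d" "j < d" by auto
    have "(adjoint_c (phase_mat d x) * phase_mat d x) $$ (i, j) =
        (\<Sum>k<d. cnj (if k = i then cis (2 * pi * x k) else 0) * (if k = j then cis (2 * pi * x k) else 0))"
      using ij by (simp add: adjoint_c_def phase_mat_def scalar_prod_def atLeast0LessThan)
    also have "\<dots> = (\<Sum>k<d. if k = i then (if i = j then 1 else 0) else 0)"
      by (intro sum.cong) (auto simp: cis_cnj cis_mult)
    also have "\<dots> = (1\<^sub>m d) $$ (i, j)"
      using ij by simp
    finally show "(adjoint_c (phase_mat d x) * phase_mat d x) $$ (i, j) = (1\<^sub>m d) $$ (i, j)" .
  qed (simp_all add: adjoint_c_def phase_mat_def)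
  then show ?thesis by (simp add: unitary_c_def phase_mat_def)
qed

lemma phase_mat_mult_phase_vec: "phase_mat d x *\<^sub>v phase_vec d p = phase_vec d (\<lambda>j. p j + x j)"
proof (rule eq_vecI)
  fix i assume "i < dim_vec (phase_vec d (\<lambda>j. p j + x j))"
  then have i: "i < d" by (simp add: phase_vec_def)
  have "(phase_mat d x *\<^sub>v phase_vec d p) $ i =
     (\<Sum>j<d. (if i = j then cis (2 * pi * x i) else 0) * (cis (2 * pi * p j) / complex_of_real (sqrt (real d))))"
    using i by (simp add: phase_mat_def phase_vec_def scalar_prod_def atLeast0LessThan)
  also have "\<dots> = (\<Sum>j<d. if i = j then cis (2 * pi * (p i + x i)) / complex_of_real (sqrt (real d)) else 0)"
    by (intro sum.cong) (auto simp: cis_mult algebra_simps)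
  also have "\<dots> = phase_vec d (\<lambda>j. p j + x j) $ i"
    using i by (simp add: phase_vec_def)
  finally show "(phase_mat d x *\<^sub>v phase_vec d p) $ i = phase_vec d (\<lambda>j. p j + x j) $ i" .
qed (simp add: phase_mat_def phase_vec_def)

lemma qrun_phase:
  "qrun (phase_vec d (\<lambda>_. 0)) (\<lambda>\<sigma>. phase_mat d (x \<sigma>)) w n = phase_vec d (\<lambda>j. \<Sum>k<n. x (w k) j)"
  by (induction n) (simp_all add: phase_mat_mult_phase_vec)

lemma subspace_line_c:
  assumes "v \<in> carrier_vec d"
  shows "subspace_c d (line_c v)"
  unfolding subspace_c_def line_c_def
proof (intro conjI ballI allI subsetI)
  show "0\<^sub>v d \<in> {c \<cdot>\<^sub>v v | c. True}"
    using assms by (auto intro!: exI[of _ 0])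
next
  fix x y assume "x \<in> {c \<cdot>\<^sub>v v | c. True}" "y \<in> {c \<cdot>\<^sub>v v | c. True}"
  then obtain a b where "x = a \<cdot>\<^sub>v v" "y = b \<cdot>\<^sub>v v" by blast
  then have "x + y = (a + b) \<cdot>\<^sub>v v" by (simp add: add_smult_distrib_vec)
  then show "x + y \<in> {c \<cdot>\<^sub>v v | c. True}" by blast
next
  fix c x assume "x \<in> {c \<cdot>\<^sub>v v | c. True}"
  then obtain a where "x = a \<cdot>\<^sub>v v" by blast
  then have "c \<cdot>\<^sub>v x = (c * a) \<cdot>\<^sub>v v" by (simp add: smult_smult_assoc)
  then show "c \<cdot>\<^sub>v x \<in> {c \<cdot>\<^sub>v v | c. True}" by blast
qed (use assms in auto)

text \<open>Unit vectors on the same line differ by a scalar of modulus 1, so the supremum over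
  \<open>\<psi>\<close> in \<open>f_ND\<close> reduces to the single vector
  \<open>v\<close>.\<close>

lemma norm_braket_line_c:
  assumes "unit_vec_c d v" "\<psi> \<in> line_c v" "unit_vec_c d \<psi>" "s \<in> carrier_vec d"
  shows "cmod (braket \<psi> s) = cmod (braket v s)"
proof -
  obtain c where c: "\<psi> = c \<cdot>\<^sub>v v" using assms(2) by (auto simp: line_c_def)
  have "dim_vec v = d" using assms(1) by (auto simp: unit_vec_c_def)
  then have sc: "braket \<psi> t = cnj c * braket v t" if "t \<in> carrier_vec d" for t
    using that by (simp add: c braket_def sum_distrib_left mult.assoc)
  have "braket v \<psi> = c * braket v v"
    by (simp add: c braket_def sum_distrib_left mult_ac)
  then have "1 = cnj c * c"
    using sc[of \<psi>] assms(1,3) by (simp add: unit_vec_c_def)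
  then have "(cmod c)\<^sup>2 = 1"
    by (metis complex_norm_square mult.commute of_real_eq_1_iff)
  then have "cmod c = 1"
    by (metis norm_ge_zero one_power2 power2_eq_iff_nonneg zero_le_one)
  then show ?thesis
    using sc[OF assms(4)] by (simp add: norm_mult)
qed

text \<open>The squared modulus of the mean of \<open>d\<close> unit complex numbers. For
  \<open>d > 0\<close> it equals 1 exactly when all phase differences to \<open>p\<close> agree
  modulo 1.\<close>

definition phase_overlap :: "nat \<Rightarrow> (nat \<Rightarrow> nat \<Rightarrow> real) \<Rightarrow> (nat \<Rightarrow> real) \<Rightarrow> nat word \<Rightarrow> nat \<Rightarrow> real" where
  "phase_overlap d x p w n = (cmod (\<Sum>j<d. cis (2 * pi * ((\<Sum>k<n. x (w k) j) - p j))) / real d)\<^sup>2"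

abbreviation phase_f :: "nat \<Rightarrow> (nat \<Rightarrow> nat \<Rightarrow> real) \<Rightarrow> (nat \<Rightarrow> real) \<Rightarrow> nat word \<Rightarrow> real" where
  "phase_f d x p w \<equiv>
     f_ND d (phase_vec d (\<lambda>_. 0)) (\<lambda>\<sigma>. phase_mat d (x \<sigma>)) (line_c (phase_vec d p)) w"

lemma quantum_automaton_phase:
  assumes "finite \<Sigma>" "d > 0"
  shows "quantum_automaton \<Sigma> d (phase_vec d (\<lambda>_. 0)) (\<lambda>\<sigma>. phase_mat d (x \<sigma>)) (line_c (phase_vec d p))"
  unfolding quantum_automaton_def
  using assms by (auto simp: unit_phase_vec unitary_phase_mat intro!: subspace_line_c) (simp add: phase_vec_def)

lemma phase_overlap_eq:
  assumes "d > 0" "\<psi> \<in> line_c (phase_vec d p)" "unit_vec_c d \<psi>"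
  shows "(cmod (braket \<psi> (qrun (phase_vec d (\<lambda>_. 0)) (\<lambda>\<sigma>. phase_mat d (x \<sigma>)) w n)))\<^sup>2 = phase_overlap d x p w n"
proof -
  have "phase_vec d (\<lambda>j. \<Sum>k<n. x (w k) j) \<in> carrier_vec d" by (simp add: phase_vec_def)
  from norm_braket_line_c[OF unit_phase_vec[OF assms(1)] assms(2,3) this] assms(1)
  show ?thesis
    by (simp add: qrun_phase braket_phase_vec phase_overlap_def norm_divide)
qed

text \<open>The infinitely many positions with overlap at least \<open>c\<close> are enumerated
  increasingly and used as the index sequence. With \<open>phase_f_gtD\<close> as converse,
  \<open>phase_f\<close> can be handled as a limit superior of overlaps.\<close>

lemma phase_f_geI:
  assumes "finite \<Sigma>" "d > 0" "w \<in> omega_words \<Sigma>" "\<forall>m. \<exists>n\<ge>m. c \<le> phase_overlap d x p w n"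
  shows "c \<le> phase_f d x p w"
proof -
  have "infinite {n. c \<le> phase_overlap d x p w n}"
    using assms(4) by (auto simp: infinite_nat_iff_unbounded_le)
  then obtain r :: "nat \<Rightarrow> nat" where r: "strict_mono r" "\<And>n. c \<le> phase_overlap d x p w (r n)"
    using infinite_enumerate by blast
  have mem: "phase_vec d p \<in> line_c (phase_vec d p)"
    by (auto simp: line_c_def intro!: exI[of _ 1])
  show ?thesis
    by (rule f_ND_ge[OF quantum_automaton_phase[OF assms(1,2)] assms(3) mem unit_phase_vec[OF assms(2)] r(1)])
       (simp add: phase_overlap_eq[OF assms(2) mem unit_phase_vec[OF assms(2)]] r(2))
qed

lemma phase_f_gtD:
  assumes "d > 0" "0 \<le> lam" "lam < phase_f d x p w"
  obtains c where "lam < c" "\<forall>m. \<exists>n\<ge>m. c \<le> phase_overlap d x p w n"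
proof -
  obtain \<psi> and n :: "nat \<Rightarrow> nat" and c where *: "\<psi> \<in> line_c (phase_vec d p)" "unit_vec_c d \<psi>" "strict_mono n" "lam < c"
    "\<And>i. c \<le> (cmod (braket \<psi> (qrun (phase_vec d (\<lambda>_. 0)) (\<lambda>\<sigma>. phase_mat d (x \<sigma>)) w (n i))))\<^sup>2"
    using f_ND_gtE[OF assms(3,2)] by blast
  have "\<exists>k\<ge>m. c \<le> phase_overlap d x p w k" for m
    using *(5)[of m] seq_suble[OF *(3), of m] phase_overlap_eq[OF assms(1) *(1,2)] by auto
  with *(4) that show thesis by blast
qed

lemma phase_f_le_1:
  assumes "finite \<Sigma>" "d > 0" "w \<in> omega_words \<Sigma>"
  shows "phase_f d x p w \<le> 1"
  by (rule f_ND_le_1[OF quantum_automaton_phase[OF assms(1,2)] assms(3)])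

section \<open>Density of irrational rotations on the circle\<close>

lemma cis_multiples_dense:
  assumes "\<theta> \<notin> \<rat>" "\<epsilon> > 0"
  obtains k :: nat where "k > 0" "cmod (cis (2 * pi * (real k * \<theta> - \<alpha>)) - 1) < \<epsilon>"
proof -
  have "\<epsilon> / (2 * pi) > 0" using assms(2) by simp
  then obtain h k :: int where hk: "k > 0" "\<bar>of_int k * \<theta> - of_int h - \<alpha>\<bar> < \<epsilon> / (2 * pi)"
    using sequence_of_fractional_parts_is_dense[OF assms(1)] by metis
  let ?t = "2 * pi * (of_int k * \<theta> - of_int h - \<alpha>)"
  \<comment> \<open>The integer \<open>h\<close> from Kronecker's theorem is a number of full turns
    and disappears under \<open>cis\<close>; the rest is
    \<open>|cis t - 1| = 2 |sin (t / 2)| \<le> |t|\<close>.\<close>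
  have "cis (2 * pi * (real (nat k) * \<theta> - \<alpha>)) = cis (?t + 2 * pi * of_int h)"
    using hk(1) by (simp add: algebra_simps)
  also have "\<dots> = cis ?t"
    by (simp flip: cis_mult add: cis_multiple_2pi)
  finally have "cmod (cis (2 * pi * (real (nat k) * \<theta> - \<alpha>)) - 1) = cmod (cis ?t - cis 0)"
    by simp
  also have "\<dots> \<le> \<bar>?t\<bar>"
    using abs_sin_x_le_abs_x[of "?t / 2"] dist_exp_i_1[of ?t] by (simp add: cis_conv_exp)
  also have "\<dots> < \<epsilon>"
    using hk(2) by (simp only: abs_mult) (simp add: pos_less_divide_eq mult.commute)
  finally show thesis using that[of "nat k"] hk(1) by simp
qed

lemma ex_irrational: "\<exists>\<theta>::real. \<theta> \<notin> \<rat>"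
  using uncountable_UNIV_real countable_rat by (metis UNIV_eq_I)

section \<open>A non-regular language for every positive cut point\<close>

lemma not_omega_RL_if_quots_distinct:
  assumes "inj (\<lambda>n. omega_quot (g (n::nat)) L)"
  shows "L \<notin> omega_RL \<Sigma>"
proof
  assume "L \<in> omega_RL \<Sigma>"
  then have "finite (range (\<lambda>u. omega_quot u L))" by (rule finite_omega_quots)
  then have "finite (range (\<lambda>n. omega_quot (g n) L))"
    by (rule rev_finite_subset) auto
  with assms show False using finite_imageD by blast
qed

text \<open>Letter 0 rotates one of two coordinates by \<open>\<theta>\<close> and letter 1 does
  nothing, so on \<open>0^n 1^\<omega>\<close> the overlap is eventually the constant
  \<open>g n\<close>, which is the squared cosine of \<open>pi * n * \<theta>\<close>. Acceptance of
  these words separates the quotients by powers of 0.\<close>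

lemma QBA_ND_gt_not_RL:
  assumes lam: "0 < lam" "lam < 1"
  shows "\<exists>L \<in> QBA_ND_gt {0, 1} lam. L \<notin> omega_RL {0, 1}"
proof -
  obtain \<theta> :: real where \<theta>: "\<theta> \<notin> \<rat>" using ex_irrational by blast
  define x :: "nat \<Rightarrow> nat \<Rightarrow> real" where "x = (\<lambda>\<sigma> j. if \<sigma> = 0 \<and> j = 0 then \<theta> else 0)"
  define L where "L = {w \<in> omega_words {0, 1}. phase_f 2 x (\<lambda>_. 0) w > lam}"
  define W where "W = (\<lambda>n. replicate n (0::nat) \<frown> (\<lambda>_. 1::nat))"
  define g where "g = (\<lambda>n::nat. (cmod (cis (2 * pi * (real n * \<theta>)) + 1) / 2)\<^sup>2)"
  have WO: "W n \<in> omega_words {0, 1}" for n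
    by (auto simp: W_def omega_words_def conc_def)
  have phase: "(\<Sum>k<m. x (W n k) j) = (if j = 0 then real n * \<theta> else 0)" if "n \<le> m" for n m j
  proof -
    have "(\<Sum>k<m. x (W n k) j) = (\<Sum>k<m. if k \<in> {..<n} then (if j = 0 then \<theta> else 0) else 0)"
      by (intro sum.cong) (auto simp: x_def W_def conc_def)
    also have "\<dots> = (\<Sum>k\<in>{..<n}. if j = 0 then \<theta> else 0)"
      using that by (subst sum.inter_restrict[symmetric]) (auto simp: Int_absorb1)
    finally show ?thesis by simp
  qed
  have overlap: "phase_overlap 2 x (\<lambda>_. 0) (W n) m = g n" if "n \<le> m" for n m
    using phase[OF that] by (simp add: phase_overlap_def g_def numeral_2_eq_2)
  have WL: "W n \<in> L \<longleftrightarrow> lam < g n" for n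
  proof
    assume "W n \<in> L"
    then have "lam < phase_f 2 x (\<lambda>_. 0) (W n)" by (simp add: L_def)
    then obtain c where c: "lam < c" "\<forall>m. \<exists>k\<ge>m. c \<le> phase_overlap 2 x (\<lambda>_. 0) (W n) k"
      using phase_f_gtD[of 2 lam x "\<lambda>_. 0" "W n"] lam by auto
    then obtain k where "k \<ge> n" "c \<le> phase_overlap 2 x (\<lambda>_. 0) (W n) k" by blast
    then show "lam < g n" using c(1) overlap by simp
  next
    assume *: "lam < g n"
    have "\<forall>m. \<exists>k\<ge>m. g n \<le> phase_overlap 2 x (\<lambda>_. 0) (W n) k"
      using overlap by (metis le_cases order_refl)
    then have "g n \<le> phase_f 2 x (\<lambda>_. 0) (W n)"
      using WO by (intro phase_f_geI[of "{0, 1}"]) auto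
    then show "W n \<in> L" using * WO by (simp add: L_def)
  qed
  have no_eq: False if mn: "m < n" and eq: "omega_quot (replicate m 0) L = omega_quot (replicate n 0) L" for m n
  proof -
    \<comment> \<open>Equal quotients make acceptance of \<open>W\<close> invariant under adding
      \<open>q\<close> letters 0 from \<open>m\<close> on. As \<open>q * \<theta>\<close> is
      irrational, \<open>g\<close> comes near both 1 and 0 along this progression.\<close>
    define q where "q = n - m"
    have q: "q > 0" "n = m + q" using mn by (auto simp: q_def)
    have step: "lam < g (m + k) \<longleftrightarrow> lam < g (m + q + k)" for k
    proof -
      have "replicate i 0 \<frown> W k = W (i + k)" for i
        by (simp add: W_def replicate_add)
      then have "W (i + k) \<in> L \<longleftrightarrow> W k \<in> omega_quot (replicate i 0) L" for i
        by (simp add: omega_quot_def)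
      then show ?thesis using eq WL q(2) by metis
    qed
    have periodic: "lam < g (m + k * q) \<longleftrightarrow> lam < g m" for k
    proof (induction k)
      case (Suc k)
      then show ?case using step[of "k * q"] by (simp add: algebra_simps)
    qed simp
    have irr: "real q * \<theta> \<notin> \<rat>"
    proof
      assume "real q * \<theta> \<in> \<rat>"
      then have "real q * \<theta> / real q \<in> \<rat>" by (intro Rats_divide) auto
      with \<theta> q(1) show False by simp
    qed
    have shift: "cis (2 * pi * (real (m + k * q) * \<theta>)) = cis (2 * pi * (real k * (real q * \<theta>) - (\<alpha> - real m * \<theta>))) * cis (2 * pi * \<alpha>)"
      for k \<alpha> by (simp add: cis_mult algebra_simps)
    have "lam < g m"
    proof -
      \<comment> \<open>With this tolerance around phase 0, \<open>g\<close> exceeds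
        \<open>(1 - \<epsilon> / 2)^2\<close>, and that equals
        \<open>lam + (\<epsilon> / 2)^2\<close>.\<close>
      define \<epsilon> where "\<epsilon> = 1 - lam"
      have "\<epsilon> > 0" using lam by (simp add: \<epsilon>_def)
      then obtain k where k: "cmod (cis (2 * pi * (real k * (real q * \<theta>) - (0 - real m * \<theta>))) - 1) < \<epsilon>"
        using cis_multiples_dense[OF irr] by metis
      let ?z = "cis (2 * pi * (real (m + k * q) * \<theta>))"
      have "cmod (?z - 1) < \<epsilon>" using k shift[of k 0] by simp
      then have "2 - \<epsilon> < cmod (?z + 1)"
        using norm_triangle_ineq[of "?z + 1" "1 - ?z"] by (simp add: norm_minus_commute)
      then have "(1 - \<epsilon> / 2)\<^sup>2 < g (m + k * q)"
        unfolding g_def using lam by (intro power_strict_mono) (auto simp: \<epsilon>_def field_simps)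
      moreover have "(1 - \<epsilon> / 2)\<^sup>2 = lam + (\<epsilon> / 2)\<^sup>2" by (simp add: \<epsilon>_def power2_eq_square field_simps)
      ultimately have "lam < g (m + k * q)" using zero_le_power2[of "\<epsilon> / 2"] by linarith
      then show ?thesis using periodic by blast
    qed
    moreover have "\<not> lam < g m"
    proof -
      \<comment> \<open>Near phase 1/2 the two coordinates almost cancel. Tolerance
        \<open>lam\<close> is available because \<open>lam\<close> is positive, and
        \<open>(lam / 2)^2 \<le> lam\<close> is enough for rejection.\<close>
      obtain k where k: "cmod (cis (2 * pi * (real k * (real q * \<theta>) - (1 / 2 - real m * \<theta>))) - 1) < lam"
        using cis_multiples_dense[OF irr lam(1)] by metis
      let ?z = "cis (2 * pi * (real (m + k * q) * \<theta>))"
      have "cmod (?z + 1) < lam"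
        using k shift[of k "1 / 2"] by (simp add: norm_minus_commute)
      then have "g (m + k * q) \<le> (lam / 2)\<^sup>2"
        unfolding g_def by (intro power_mono) auto
      also have "\<dots> \<le> lam"
        using lam by (simp add: power2_eq_square field_simps)
      finally show ?thesis using periodic[of k] by simp
    qed
    ultimately show False by simp
  qed
  have "inj (\<lambda>n. omega_quot (replicate n 0) L)"
    by (rule injI) (metis no_eq nat_neq_iff)
  then have "L \<notin> omega_RL {0, 1}" by (rule not_omega_RL_if_quots_distinct)
  moreover have "L \<in> QBA_ND_gt {0, 1} lam"
    unfolding QBA_ND_gt_def L_def using quantum_automaton_phase[of "{0, 1}" 2 x "\<lambda>_. 0"] by auto
  ultimately show ?thesis by blast
qed

section \<open>A language without ultimately periodic words\<close>

lemma omega_RL_imp_ultimately_periodic: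
  assumes "L \<in> omega_RL \<Sigma>" "L \<noteq> {}"
  obtains u v where "v \<noteq> []" "u \<frown> v\<^sup>\<omega> \<in> L"
  using assms(1) unfolding omega_RL_def mem_Collect_eq
  by (elim exE conjE) (erule ultimately_periodic_in_union[OF _ assms(2)], rule that)

lemma omega_CFL_imp_ultimately_periodic:
  assumes "L \<in> omega_CFL \<Sigma>" "L \<noteq> {}"
  obtains u v where "v \<noteq> []" "u \<frown> v\<^sup>\<omega> \<in> L"
  using assms(1) unfolding omega_CFL_def mem_Collect_eq
  by (elim exE conjE) (erule ultimately_periodic_in_union[OF _ assms(2)], rule that)

lemma prefix_iter:
  assumes "v \<noteq> []"
  shows "prefix n (v\<^sup>\<omega>) = concat (replicate (n div length v) v) @ take (n mod length v) v"
proof (induction n rule: less_induct)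
  case (less n)
  show ?case
  proof (cases "n < length v")
    case True
    have "prefix n (v\<^sup>\<omega>) = prefix n (v \<frown> v\<^sup>\<omega>)"
      using assms by (subst iter_unroll) auto
    then show ?thesis using True by simp
  next
    case False
    have "prefix n (v\<^sup>\<omega>) = prefix n (v \<frown> v\<^sup>\<omega>)"
      using assms by (subst iter_unroll) auto
    also have "\<dots> = v @ prefix (n - length v) (v\<^sup>\<omega>)"
      using False by (subst prefix_conc_snd) auto
    also have "\<dots> = v @ concat (replicate ((n - length v) div length v) v) @ take ((n - length v) mod length v) v"
      using False assms by (subst less.IH) (auto simp: not_less intro!: diff_less elim: less_le_trans[rotated])
    also have "\<dots> = concat (replicate (n div length v) v) @ take (n mod length v) v"
      using False assms by (simp add: le_div_geq le_mod_geq)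
    finally show ?thesis .
  qed
qed

text \<open>The \<open>k\<close>-th extension achieves \<open>Q k\<close>. All extensions are
  nonempty, so the finite words grow beyond every length and have an infinite limit word.\<close>

lemma ex_word_with_prefixes:
  fixes Q :: "nat \<Rightarrow> nat list \<Rightarrow> bool"
  assumes "\<And>u k. set u \<subseteq> \<Sigma> \<Longrightarrow> \<exists>x. x \<noteq> [] \<and> set x \<subseteq> \<Sigma> \<and> Q k (u @ x)"
  obtains w where "w \<in> omega_words \<Sigma>" "\<And>k. \<exists>n\<ge>k. Q k (prefix n w)"
proof -
  obtain e where e: "\<And>u k. set u \<subseteq> \<Sigma> \<Longrightarrow> e u k \<noteq> []" "\<And>u k. set u \<subseteq> \<Sigma> \<Longrightarrow> set (e u k) \<subseteq> \<Sigma>"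
    "\<And>u k. set u \<subseteq> \<Sigma> \<Longrightarrow> Q k (u @ e u k)"
    using assms by metis
  define X where "X = rec_nat [] (\<lambda>k u. u @ e u k)"
  have X: "X 0 = []" "X (Suc k) = X k @ e (X k) k" for k
    by (simp_all add: X_def)
  have set_X: "set (X k) \<subseteq> \<Sigma>" for k
    by (induction k) (use e(2) in \<open>auto simp: X\<close>)
  have len_X: "k \<le> length (X k)" for k
  proof (induction k)
    case (Suc k)
    have "length (e (X k) k) > 0" using e(1)[OF set_X] by simp
    then show ?case using Suc unfolding X(2) length_append by linarith
  qed simp
  have ext: "\<exists>y. X (k + j) = X k @ y" for k j
    by (induction j) (auto simp: X)
  have nth: "X k ! i = X l ! i" if "i < length (X k)" "i < length (X l)" for i k l
  proof (cases k l rule: le_cases)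
    case le
    then show ?thesis using ext[of k "l - k"] that by (auto simp: nth_append)
  next
    case ge
    then show ?thesis using ext[of l "k - l"] that by (auto simp: nth_append)
  qed
  \<comment> \<open>Letter \<open>i\<close> is read off at stage \<open>Suc i\<close>, the first
    stage whose length is guaranteed to exceed \<open>i\<close>.\<close>
  define w where "w = (\<lambda>i. X (Suc i) ! i)"
  have i: "i < length (X (Suc i))" for i using len_X[of "Suc i"] by simp
  have "prefix (length (X k)) w = X k" for k
    by (rule nth_equalityI) (auto simp: w_def intro!: nth i)
  then have "\<exists>n\<ge>k. Q k (prefix n w)" for k
    using e(3)[OF set_X, of k k] len_X[of "Suc k"]
    by (intro exI[of _ "length (X (Suc k))"]) (simp flip: X(2))
  moreover have "w \<in> omega_words \<Sigma>"
    unfolding omega_words_def w_def using i set_X nth_mem by blast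
  ultimately show thesis using that by blast
qed

text \<open>Countability: \<open>p1\<close> avoids the countably many values excluded for
  \<open>a = 0\<close>, then \<open>p2\<close> avoids those excluded for \<open>a > 0\<close> and
  this \<open>p1\<close>. The point lies on none of the cosets where runs on ultimately periodic
  words accumulate.\<close>

lemma ex_independent_pair:
  fixes \<theta> :: real
  obtains p1 p2 :: real where
    "\<And>(a::nat) (b::nat) (s::int) (t::int). a > 0 \<or> b > 0 \<Longrightarrow> real b * p1 - real a * p2 \<noteq> of_int s * \<theta> + of_int t"
proof -
  have ex: "\<exists>x::real. x \<notin> range f" for f :: "nat \<times> nat \<times> int \<times> int \<Rightarrow> real"
  proof (rule ccontr)
    assume "\<nexists>x. x \<notin> range f"
    then have "range f = UNIV" by blast
    then show False using uncountable_UNIV_real by (metis countableI_type countable_image)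
  qed
  obtain p1 where p1: "p1 \<notin> range (\<lambda>(a::nat, b::nat, s::int, t::int). (of_int s * \<theta> + of_int t) / real b)"
    using ex by blast
  obtain p2 where p2: "p2 \<notin> range (\<lambda>(a::nat, b::nat, s::int, t::int). (real b * p1 - (of_int s * \<theta> + of_int t)) / real a)"
    using ex by blast
  show thesis
  proof (rule that)
    fix a b :: nat and s t :: int
    assume ab: "a > 0 \<or> b > 0"
    show "real b * p1 - real a * p2 \<noteq> of_int s * \<theta> + of_int t"
    proof
      assume eq: "real b * p1 - real a * p2 = of_int s * \<theta> + of_int t"
      show False
      proof (cases "a > 0")
        case True
        then have "p2 = (real b * p1 - (of_int s * \<theta> + of_int t)) / real a"
          using eq by (simp add: field_simps)
        then have "p2 \<in> range (\<lambda>(a::nat, b::nat, s::int, t::int). (real b * p1 - (of_int s * \<theta> + of_int t)) / real a)"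
          by (intro range_eqI[where x = "(a, b, s, t)"]) simp
        with p2 show False ..
      next
        case False
        with ab eq have "p1 = (of_int s * \<theta> + of_int t) / real b"
          by (simp add: field_simps)
        then have "p1 \<in> range (\<lambda>(a::nat, b::nat, s::int, t::int). (of_int s * \<theta> + of_int t) / real b)"
          by (intro range_eqI[where x = "(a, b, s, t)"]) simp
        with p1 show False ..
      qed
    qed
  qed
qed

text \<open>The squared modulus is 3 plus twice the three pairwise real inner products, each at most
  1. A deficit of \<open>\<epsilon>\<close> from the maximum 9 therefore bounds the deficit of each
  product alone.\<close>

lemma norm_sum3_unit_close:
  fixes X Y :: complex
  assumes "cmod X = 1" "cmod Y = 1" "9 - \<epsilon> \<le> (cmod (X + Y + 1))\<^sup>2"
  shows "(cmod (X - 1))\<^sup>2 \<le> \<epsilon>" "(cmod (Y - 1))\<^sup>2 \<le> \<epsilon>"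
proof -
  have sq: "(Re X)\<^sup>2 + (Im X)\<^sup>2 = 1" "(Re Y)\<^sup>2 + (Im Y)\<^sup>2 = 1"
    using assms(1,2) by (simp_all add: cmod_def)
  define s where "s = Re X * Re Y + Im X * Im Y"
  have "(Re X - Re Y)\<^sup>2 + (Im X - Im Y)\<^sup>2 \<ge> 0" by simp
  then have 1: "s \<le> 1" using sq by (simp add: s_def power2_eq_square algebra_simps)
  have 2: "Re X \<le> 1" "Re Y \<le> 1"
    using complex_Re_le_cmod[of X] complex_Re_le_cmod[of Y] assms by auto
  have "(cmod (X + Y + 1))\<^sup>2 = 3 + 2 * Re X + 2 * Re Y + 2 * s"
    using sq unfolding cmod_power2 s_def by (simp add: power2_eq_square algebra_simps)
  with assms(3) 1 2 have "2 - 2 * Re X \<le> \<epsilon> \<and> 2 - 2 * Re Y \<le> \<epsilon>" by (intro conjI) linarith+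
  moreover have "(cmod (X - 1))\<^sup>2 = 2 - 2 * Re X" "(cmod (Y - 1))\<^sup>2 = 2 - 2 * Re Y"
    using sq unfolding cmod_power2 by (simp_all add: power2_eq_square algebra_simps)
  ultimately show "(cmod (X - 1))\<^sup>2 \<le> \<epsilon>" "(cmod (Y - 1))\<^sup>2 \<le> \<epsilon>" by simp_all
qed

lemma cis_2pi_eq_1_iff: "cis (2 * pi * t) = 1 \<longleftrightarrow> t \<in> \<int>"
proof
  assume "cis (2 * pi * t) = 1"
  then have "cos (2 * pi * t) = 1" by (metis cis.sel(1) one_complex.sel(1))
  then obtain n :: int where "2 * pi * t = of_int n * 2 * pi"
    using cos_one_2pi_int by blast
  then have "t = of_int n" by simp
  then show "t \<in> \<int>" by simp
qed (rule cis_multiple_2pi)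

text \<open>Coordinates 0 and 1 carry the torus; coordinate 2 is a phase reference that no letter of
  the alphabet moves. Without it a common rotation of the first two phases would be invisible to the
  overlap.\<close>

lemma QBA_ND_eq1_aperiodic:
  obtains L where "L \<in> QBA_ND_eq1 {0, 1}" "L \<noteq> {}" "\<And>u v. v \<noteq> [] \<Longrightarrow> u \<frown> v\<^sup>\<omega> \<notin> L"
proof -
  obtain \<theta> :: real where \<theta>: "\<theta> \<notin> \<rat>" using ex_irrational by blast
  obtain p1 p2 :: real where indep:
    "\<And>(a::nat) (b::nat) (s::int) (t::int). a > 0 \<or> b > 0 \<Longrightarrow> real b * p1 - real a * p2 \<noteq> of_int s * \<theta> + of_int t"
    using ex_independent_pair[of \<theta>] by metis
  define x :: "nat \<Rightarrow> nat \<Rightarrow> real" where "x = (\<lambda>\<sigma> j. if \<sigma> = j then \<theta> else 0)"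
  define p :: "nat \<Rightarrow> real" where "p = (\<lambda>j. if j = 0 then p1 else if j = 1 then p2 else 0)"
  define L where "L = {w \<in> omega_words {0, 1}. phase_f 3 x p w = 1}"
  define X where "X = (\<lambda>u. cis (2 * pi * (real (count_list u (0::nat)) * \<theta> - p1)))"
  define Y where "Y = (\<lambda>u. cis (2 * pi * (real (count_list u (1::nat)) * \<theta> - p2)))"
  have phase: "(\<Sum>k<n. x (w k) j) = real (count_list (prefix n w) j) * \<theta>" for n w j
    by (induction n) (auto simp: x_def algebra_simps)
  have overlap: "phase_overlap 3 x p w n = (cmod (X (prefix n w) + Y (prefix n w) + 1) / 3)\<^sup>2"
    if "w \<in> omega_words {0, 1}" for w n
  proof -
    \<comment> \<open>By its definition \<open>x\<close> would let a letter 2 rotate the reference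
      coordinate, but no such letter occurs.\<close>
    have "count_list (prefix n w) 2 = 0"
      using that by (auto simp: count_list_0_iff omega_words_def) (metis n_not_Suc_n numeral_2_eq_2 zero_neq_numeral)
    then show ?thesis
      by (simp add: phase_overlap_def phase numeral_3_eq_3 X_def Y_def p_def numeral_2_eq_2 add.assoc)
  qed
  have in_L: "w \<in> L \<longleftrightarrow> (\<forall>\<epsilon>>0. \<forall>m. \<exists>n\<ge>m. cmod (X (prefix n w) - 1) < \<epsilon> \<and> cmod (Y (prefix n w) - 1) < \<epsilon>)"
    (is "_ \<longleftrightarrow> ?R") if w: "w \<in> omega_words {0, 1}" for w
  proof
    assume "w \<in> L"
    then have f1: "phase_f 3 x p w = 1" by (simp add: L_def)
    show ?R
    proof (intro allI impI)
      fix \<epsilon> :: real and m assume "\<epsilon> > 0"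
      \<comment> \<open>Overlap above \<open>1 - \<delta>\<close> puts both squared distances below
        \<open>9 * \<delta>\<close>, hence the 18; the minimum with 1 keeps the cut point
        \<open>1 - \<delta>\<close> nonnegative.\<close>
      define \<delta> where "\<delta> = min 1 (\<epsilon>\<^sup>2 / 18)"
      have \<delta>: "0 < \<delta>" "\<delta> \<le> 1" "9 * \<delta> < \<epsilon>\<^sup>2" using \<open>\<epsilon> > 0\<close> by (auto simp: \<delta>_def min_def)
      have "1 - \<delta> < phase_f 3 x p w" "0 \<le> 1 - \<delta>" using f1 \<delta> by auto
      then obtain c where c: "1 - \<delta> < c" "\<forall>m. \<exists>n\<ge>m. c \<le> phase_overlap 3 x p w n"
        using phase_f_gtD[of 3 "1 - \<delta>" x p w] by auto
      then obtain n where n: "n \<ge> m" "c \<le> phase_overlap 3 x p w n" by blast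
      have "9 - 9 * \<delta> \<le> (cmod (X (prefix n w) + Y (prefix n w) + 1))\<^sup>2"
        using n(2) c(1) by (simp add: overlap[OF w] power_divide)
      then have "(cmod (X (prefix n w) - 1))\<^sup>2 \<le> 9 * \<delta>" "(cmod (Y (prefix n w) - 1))\<^sup>2 \<le> 9 * \<delta>"
        using norm_sum3_unit_close[of "X (prefix n w)" "Y (prefix n w)" "9 * \<delta>"] by (auto simp: X_def Y_def)
      then have "(cmod (X (prefix n w) - 1))\<^sup>2 < \<epsilon>\<^sup>2" "(cmod (Y (prefix n w) - 1))\<^sup>2 < \<epsilon>\<^sup>2"
        using \<delta>(3) by auto
      then show "\<exists>n\<ge>m. cmod (X (prefix n w) - 1) < \<epsilon> \<and> cmod (Y (prefix n w) - 1) < \<epsilon>"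
        using n(1) \<open>\<epsilon> > 0\<close> power2_less_imp_less[of _ \<epsilon>] by (intro exI[of _ n]) auto
    qed
  next
    assume R: ?R
    have "1 - \<delta> \<le> phase_f 3 x p w" if "0 < \<delta>" for \<delta>
    proof (rule phase_f_geI[of "{0, 1}"])
      show "\<forall>m. \<exists>n\<ge>m. 1 - \<delta> \<le> phase_overlap 3 x p w n"
      proof
        fix m
        \<comment> \<open>Chosen for \<open>(1 - \<epsilon>)^2 \<ge> 1 - 2 * \<epsilon> \<ge> 1 -
          \<delta>\<close>; squaring needs \<open>\<epsilon> \<le> 1\<close>.\<close>
        define \<epsilon> where "\<epsilon> = min 1 (\<delta> / 2)"
        have \<epsilon>: "0 < \<epsilon>" "\<epsilon> \<le> 1" "2 * \<epsilon> \<le> \<delta>" using that by (auto simp: \<epsilon>_def)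
        then obtain n where n: "n \<ge> m" "cmod (X (prefix n w) - 1) < \<epsilon>" "cmod (Y (prefix n w) - 1) < \<epsilon>"
          using R by blast
        let ?X = "X (prefix n w)" and ?Y = "Y (prefix n w)"
        have "cmod (3 :: complex) \<le> cmod (?X + ?Y + 1) + cmod (1 - ?X) + cmod (1 - ?Y)"
          using norm_triangle_ineq[of "?X + ?Y + 1" "(1 - ?X) + (1 - ?Y)"] norm_triangle_ineq[of "1 - ?X" "1 - ?Y"]
          by (simp add: algebra_simps)
        then have "3 - 2 * \<epsilon> \<le> cmod (?X + ?Y + 1)"
          using n by (simp add: norm_minus_commute)
        then have "1 - \<epsilon> \<le> cmod (?X + ?Y + 1) / 3" using \<epsilon> by simp
        then have "(1 - \<epsilon>)\<^sup>2 \<le> phase_overlap 3 x p w n"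
          unfolding overlap[OF w] using \<epsilon> by (intro power_mono) auto
        moreover have "1 - 2 * \<epsilon> \<le> (1 - \<epsilon>)\<^sup>2" by (simp add: power2_eq_square algebra_simps)
        ultimately show "\<exists>n\<ge>m. 1 - \<delta> \<le> phase_overlap 3 x p w n"
          using n(1) \<epsilon>(3) by (intro exI[of _ n]) auto
      qed
    qed (use w in auto)
    then have "1 \<le> phase_f 3 x p w"
      by (metis diff_le_eq field_le_epsilon)
    moreover have "phase_f 3 x p w \<le> 1" using w by (intro phase_f_le_1[of "{0, 1}"]) auto
    ultimately show "w \<in> L" using w by (simp add: L_def)
  qed
  have "L \<noteq> {}"
  proof -
    have ext: "\<exists>y. y \<noteq> [] \<and> set y \<subseteq> {0, 1} \<and>
        (cmod (X (u @ y) - 1) < 1 / Suc k \<and> cmod (Y (u @ y) - 1) < 1 / Suc k)"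
      if "set u \<subseteq> {0, 1}" for u k
    proof -
      have pos: "1 / real (Suc k) > 0" by simp
      \<comment> \<open>The two letter counts are adjusted independently: \<open>a\<close> zeros
        correct the first phase and \<open>b\<close> ones the second, each by density. Positivity of
        \<open>a\<close> makes the extension nonempty.\<close>
      obtain a where a: "a > 0" "cmod (cis (2 * pi * (real a * \<theta> - (p1 - real (count_list u 0) * \<theta>))) - 1) < 1 / Suc k"
        by (rule cis_multiples_dense[OF \<theta> pos])
      obtain b where b: "cmod (cis (2 * pi * (real b * \<theta> - (p2 - real (count_list u 1) * \<theta>))) - 1) < 1 / Suc k"
        by (rule cis_multiples_dense[OF \<theta> pos])
      have rep: "count_list (replicate i c) c' = (if c = c' then i else 0)" for i c c'
        by (induction i) auto
      show ?thesis
        using a b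
        by (intro exI[of _ "replicate a 0 @ replicate b 1"])
           (auto simp: X_def Y_def rep algebra_simps)
    qed
    obtain w where w: "w \<in> omega_words {0, 1}"
      "\<And>k. \<exists>n\<ge>k. cmod (X (prefix n w) - 1) < 1 / Suc k \<and> cmod (Y (prefix n w) - 1) < 1 / Suc k"
      by (rule ex_word_with_prefixes[of "{0, 1}"
            "\<lambda>k u. cmod (X u - 1) < 1 / Suc k \<and> cmod (Y u - 1) < 1 / Suc k", OF ext]) (assumption, rule that)
    have "w \<in> L"
      unfolding in_L[OF w(1)]
    proof (intro allI impI)
      fix \<epsilon> :: real and m :: nat assume "\<epsilon> > 0"
      then obtain K where K: "1 / real (Suc K) < \<epsilon>" using nat_approx_posE by blast
      obtain n where n: "n \<ge> max K m" "cmod (X (prefix n w) - 1) < 1 / Suc (max K m)"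
          "cmod (Y (prefix n w) - 1) < 1 / Suc (max K m)"
        using w(2) by blast
      have "1 / real (Suc (max K m)) \<le> 1 / real (Suc K)" by (intro divide_left_mono) auto
      with n K show "\<exists>n\<ge>m. cmod (X (prefix n w) - 1) < \<epsilon> \<and> cmod (Y (prefix n w) - 1) < \<epsilon>"
        by (intro exI[of _ n]) auto
    qed
    then show ?thesis by blast
  qed
  moreover have "u \<frown> v\<^sup>\<omega> \<notin> L" if v: "v \<noteq> []" for u v
  proof
    let ?w = "u \<frown> v\<^sup>\<omega>"
    assume "?w \<in> L"
    then have w: "?w \<in> omega_words {0, 1}" by (simp add: L_def)
    define a where "a = count_list v 0"
    define b where "b = count_list v 1"
    have "hd v \<in> {0, 1}"
    proof -
      have "?w (length u) = hd v" using v by (simp add: hd_conv_nth)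
      then show ?thesis using w by (metis (mono_tags, lifting) mem_Collect_eq omega_words_def)
    qed
    then have ab: "a > 0 \<or> b > 0"
      unfolding a_def b_def using v by (cases v) auto
    \<comment> \<open>\<open>b\<close> times the first phase minus \<open>a\<close> times the second is unchanged by reading \<open>v\<close>.\<close>
    define T where "T = (\<lambda>r. int b * int (count_list u 0 + count_list (take r v) 0)
                            - int a * int (count_list u 1 + count_list (take r v) 1))"
    define D where "D = (\<lambda>r. cis (2 * pi * (of_int (T r) * \<theta> - (real b * p1 - real a * p2))))"
    have D1: "D r \<noteq> 1" for r
    proof
      assume "D r = 1"
      then obtain t :: int where "of_int (T r) * \<theta> - (real b * p1 - real a * p2) = of_int t"
        unfolding D_def cis_2pi_eq_1_iff by (elim Ints_cases)
      then have "real b * p1 - real a * p2 = of_int (T r) * \<theta> + of_int (- t)" by simp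
      with indep[OF ab] show False by blast
    qed
    \<comment> \<open>\<open>D r\<close> depends only on the position \<open>r\<close> inside
      \<open>v\<close>, so finitely many values have a common positive distance from 1.\<close>
    define \<mu> where "\<mu> = Min ((\<lambda>r. cmod (D r - 1)) ` {..<length v})"
    have "(\<lambda>r. cmod (D r - 1)) ` {..<length v} \<noteq> {}"
      using v by (simp add: lessThan_empty_iff)
    then have \<mu>: "\<mu> > 0" "\<And>r. r < length v \<Longrightarrow> \<mu> \<le> cmod (D r - 1)"
      using D1 unfolding \<mu>_def by (subst Min_gr_iff) auto
    \<comment> \<open>Passing from \<open>X\<close> and \<open>Y\<close> to
      \<open>X^b * cnj Y^a\<close> multiplies the error by at most \<open>a + b\<close>, which
      leaves \<open>\<mu> / 2\<close>.\<close>
    define \<epsilon> where "\<epsilon> = \<mu> / 2 / (real a + real b)"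
    have ab': "real a + real b > 0" using ab by auto
    have \<epsilon>: "\<epsilon> > 0" using \<mu>(1) ab' by (simp add: \<epsilon>_def)
    then obtain n where n: "n \<ge> length u" "cmod (X (prefix n ?w) - 1) < \<epsilon>" "cmod (Y (prefix n ?w) - 1) < \<epsilon>"
      using \<open>?w \<in> L\<close> in_L[OF w] by blast
    define k where "k = (n - length u) div length v"
    define r where "r = (n - length u) mod length v"
    have r: "r < length v" using v by (simp add: r_def)
    have pre: "prefix n ?w = u @ concat (replicate k v) @ take r v"
      using n(1) prefix_iter[OF v, of "n - length u"] by (simp add: k_def r_def)
    have rep: "count_list (concat (replicate k v)) c = k * count_list v c" for c
      by (induction k) auto
    let ?X = "X (prefix n ?w)" and ?Y = "Y (prefix n ?w)"
    have cv: "count_list v 0 = a" "count_list v (Suc 0) = b" by (simp_all add: a_def b_def)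
    \<comment> \<open>The \<open>k\<close> complete copies of \<open>v\<close> add
      \<open>k * a * b\<close> rotations through \<open>X^b\<close> and remove as many through
      \<open>cnj Y^a\<close>.\<close>
    have XY: "?X ^ b * cnj ?Y ^ a = D r"
      by (simp add: X_def Y_def D_def T_def pre rep Complex.DeMoivre cis_cnj cis_mult cv)
         (simp add: algebra_simps)
    have "cmod (D r - 1) = cmod ((?X ^ b - 1) * cnj ?Y ^ a + (cnj ?Y ^ a - 1))"
      unfolding left_diff_distrib XY by simp
    also have "\<dots> \<le> cmod (?X ^ b - 1) + cmod (cnj ?Y ^ a - 1)"
      by (rule order_trans[OF norm_triangle_ineq]) (simp add: norm_mult norm_power Y_def)
    also have "\<dots> \<le> real b * \<epsilon> + real a * \<epsilon>"
    proof (rule add_mono)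
      have "cmod (?X ^ b - 1 ^ b) \<le> real b * cmod (?X - 1)"
        by (rule norm_power_diff) (auto simp: X_def)
      also have "\<dots> \<le> real b * \<epsilon>" using n(2) by (intro mult_left_mono) auto
      finally show "cmod (?X ^ b - 1) \<le> real b * \<epsilon>" by simp
      have "cmod (cnj ?Y ^ a - 1 ^ a) \<le> real a * cmod (cnj ?Y - 1)"
        by (rule norm_power_diff) (auto simp: Y_def)
      also have "cmod (cnj ?Y - 1) = cmod (?Y - 1)"
        by (metis complex_cnj_diff complex_cnj_one complex_mod_cnj)
      also have "real a * cmod (?Y - 1) \<le> real a * \<epsilon>" using n(3) by (intro mult_left_mono) auto
      finally show "cmod (cnj ?Y ^ a - 1) \<le> real a * \<epsilon>" by simp
    qed
    also have "\<dots> = (real a + real b) * \<epsilon>" by (simp add: algebra_simps)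
    also have "\<dots> = \<mu> / 2"
    proof -
      have "c * (\<mu> / 2 / c) = \<mu> / 2" if "c > 0" for c :: real using that by simp
      then show ?thesis using ab' unfolding \<epsilon>_def by blast
    qed
    also have "\<dots> < \<mu>" using \<mu>(1) by simp
    finally show False using \<mu>(2)[OF r] by simp
  qed
  moreover have "L \<in> QBA_ND_eq1 {0, 1}"
    unfolding QBA_ND_eq1_def L_def using quantum_automaton_phase[of "{0, 1}" 3 x p] by auto
  ultimately show thesis using that by blast
qed

section \<open>The languages for the non-inclusions into the cut-point classes\<close>

lemma omega_power_letter: "omega_power {[a]} = {\<lambda>_. a}"
proof
  show "omega_power {[a]} \<subseteq> {\<lambda>_. a}"
  proof
    fix x assume "x \<in> omega_power {[a]}"
    then obtain f where f: "\<forall>i. f i = [a]" "is_inf_concat f x"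
      unfolding omega_power_def by auto
    have "f = (\<lambda>_. [a])" using f(1) by auto
    moreover have "sum_list (map (length \<circ> (\<lambda>_. [a])) [0..<n]) = n"
        "concat (map (\<lambda>_. [a]) [0..<n]) = replicate n a" for n :: nat
      by (induction n) (simp_all add: replicate_append_same)
    ultimately have pre: "prefix n x = replicate n a" for n
      using f(2) by (simp add: is_inf_concat_def)
    have "x i = a" for i
      using arg_cong[OF pre[of "Suc i"], of "\<lambda>l. l ! i"] by (simp del: subseq_to_Suc replicate_Suc)
    then show "x \<in> {\<lambda>_. a}" by auto
  qed
  have "[a]\<^sup>\<omega> = (\<lambda>_. a)" by (rule ext) simp
  then show "{\<lambda>_. a} \<subseteq> omega_power {[a]}"
    using iter_in_omega_power[of "[a]" "{[a]}"] by simp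
qed

section \<open>Grammars for the context-free witnesses\<close>

lemma context_free_letter:
  assumes "a \<in> \<Sigma>"
  shows "context_free_lang \<Sigma> {[a]}"
proof -
  let ?P = "{(0::nat, [Inr a])} :: cfg_prod set"
  have inv: "x = [Inl 0] \<or> x = [Inr a]" if "(cfg_step ?P)\<^sup>*\<^sup>* [Inl 0] x" for x
    using that
  proof induction
    case (step y z)
    from step.hyps(2) obtain u v A \<alpha> where *: "y = u @ [Inl A] @ v" "z = u @ \<alpha> @ v" "(A, \<alpha>) \<in> ?P"
      by cases blast
    then have "u = []" "v = []" using step.IH by (auto simp: append_eq_Cons_conv)
    with * show ?case by simp
  qed simp
  have "cfg_step ?P ([] @ [Inl 0] @ []) ([] @ [Inr a] @ [])"
    by (rule cfg_step.intros) simp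
  then have "(cfg_step ?P)\<^sup>*\<^sup>* [Inl 0] [Inr a]" by (simp add: r_into_rtranclp)
  then have "cfg_lang ?P 0 = {[a]}"
    using inv by (fastforce simp: cfg_lang_def map_eq_Cons_conv)
  then show ?thesis
    unfolding context_free_lang_def using assms by (intro exI[of _ ?P] exI[of _ 0]) auto
qed

text \<open>The grammar is \<open>S -> [] | a S b\<close>; the invariant is that every sentential
  form is \<open>a^n S b^n\<close> or \<open>a^n b^n\<close>.\<close>

lemma context_free_balanced:
  assumes "a \<in> \<Sigma>" "b \<in> \<Sigma>"
  shows "context_free_lang \<Sigma> {replicate n a @ replicate n b | n. True}"
proof -
  let ?P = "{(0::nat, []), (0, [Inr a, Inl 0, Inr b])} :: cfg_prod set"
  let ?A = "\<lambda>n. replicate n (Inr a) @ [Inl 0] @ replicate n (Inr b) :: (nat + nat) list"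
  let ?B = "\<lambda>n. map Inr (replicate n a @ replicate n b) :: (nat + nat) list"
  have inv: "\<exists>n. x = ?A n \<or> x = ?B n" if "(cfg_step ?P)\<^sup>*\<^sup>* [Inl 0] x" for x
    using that
  proof induction
    case base
    show ?case by (rule exI[of _ 0]) simp
  next
    case (step y z)
    from step.hyps(2) obtain u v A \<alpha> where *: "y = u @ [Inl A] @ v" "z = u @ \<alpha> @ v" "(A, \<alpha>) \<in> ?P"
      by cases blast
    have "Inl A \<in> set y" using * by simp
    with step.IH obtain n where n: "y = ?A n" by auto
    have "A = 0" using *(3) by auto
    \<comment> \<open>The nonterminal occurs only once in \<open>y\<close>, which forces the place
      where the production applies.\<close>
    then have "u = replicate n (Inr a) \<and> v = replicate n (Inr b)"
      using n *(1) append_Cons_eq_iff[of "Inl 0" "replicate n (Inr a)" "replicate n (Inr b)" u v] by simp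
    then have "z = ?B n \<or> z = ?A (Suc n)"
      using *(2,3) by (auto simp: replicate_append_same replicate_app_Cons_same)
    then show ?case by blast
  qed
  have reach: "(cfg_step ?P)\<^sup>*\<^sup>* [Inl 0] (?A n)" for n
  proof (induction n)
    case (Suc n)
    have "cfg_step ?P (replicate n (Inr a) @ [Inl 0] @ replicate n (Inr b))
        (replicate n (Inr a) @ [Inr a, Inl 0, Inr b] @ replicate n (Inr b))"
      by (rule cfg_step.intros) simp
    moreover have "replicate n (Inr a) @ [Inr a, Inl 0, Inr b] @ replicate n (Inr b) = ?A (Suc n)"
      by (simp add: replicate_app_Cons_same)
    ultimately show ?case using Suc by (metis (no_types, lifting) rtranclp.rtrancl_into_rtrancl)
  qed simp
  have "(cfg_step ?P)\<^sup>*\<^sup>* [Inl 0] (?B n)" for n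
  proof -
    have "cfg_step ?P (replicate n (Inr a) @ [Inl 0] @ replicate n (Inr b))
        (replicate n (Inr a) @ [] @ replicate n (Inr b))"
      by (rule cfg_step.intros) simp
    then have "cfg_step ?P (?A n) (?B n)" by simp
    with reach show ?thesis by (rule rtranclp.rtrancl_into_rtrancl)
  qed
  moreover have "\<exists>n. w = replicate n a @ replicate n b" if w: "(cfg_step ?P)\<^sup>*\<^sup>* [Inl 0] (map Inr w)" for w
  proof -
    obtain n where n: "map Inr w = ?A n \<or> map Inr w = ?B n" using inv[OF w] by blast
    have "Inl 0 \<notin> set (map Inr w :: (nat + nat) list)" by auto
    then have "map Inr w \<noteq> ?A n" by (metis in_set_conv_decomp append_Cons append_Nil)
    with n have "map (Inr :: nat \<Rightarrow> nat + nat) w = map Inr (replicate n a @ replicate n b)" by blast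
    then have "w = replicate n a @ replicate n b"
      by (rule map_injective) simp
    then show ?thesis ..
  qed
  ultimately have "cfg_lang ?P 0 = {replicate n a @ replicate n b | n. True}"
    unfolding cfg_lang_def by blast
  then show ?thesis
    unfolding context_free_lang_def using assms by (intro exI[of _ ?P] exI[of _ 0]) auto
qed

lemma lang_conc_omega_power_RL:
  assumes "regular_lang \<Sigma> U" "regular_lang \<Sigma> V"
  shows "lang_conc U (omega_power V) \<in> omega_RL \<Sigma>"
  unfolding omega_RL_def mem_Collect_eq
  by (rule exI[of _ 1], rule exI[of _ "\<lambda>_. U"], rule exI[of _ "\<lambda>_. V"]) (use assms in auto)

lemma lang_conc_omega_power_CFL:
  assumes "context_free_lang \<Sigma> U" "context_free_lang \<Sigma> V"
  shows "lang_conc U (omega_power V) \<in> omega_CFL \<Sigma>"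
  unfolding omega_CFL_def mem_Collect_eq
  by (rule exI[of _ 1], rule exI[of _ "\<lambda>_. U"], rule exI[of _ "\<lambda>_. V"]) (use assms in auto)

lemma zero_word_RL: "{\<lambda>_. 0} \<in> omega_RL {0, 1}"
proof -
  have "regular_lang {0, 1} {[]}" "regular_lang {0, 1} {[0]}"
    unfolding regular_lang_def by (auto intro: exI[of _ ROne] exI[of _ "RAtom 0"])
  moreover have "{\<lambda>_. 0} = lang_conc {[]} (omega_power {[0::nat]})"
    by (auto simp: lang_conc_def omega_power_letter)
  ultimately show ?thesis
    using lang_conc_omega_power_RL by metis
qed

text \<open>The case \<open>n = 0\<close> puts the zero word into the language, while every word in
  it begins with 0; the recurrence argument uses both facts.\<close>

definition balanced_zero :: "nat word set" where
  "balanced_zero = {(replicate n 0 @ replicate n 1) \<frown> (\<lambda>_. 0) | n. True}"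

lemma balanced_zero_CFL: "balanced_zero \<in> omega_CFL {0, 1}"
proof -
  have cf: "context_free_lang {0, 1} {replicate n 0 @ replicate n 1 | n. True}" "context_free_lang {0, 1} {[0]}"
    by (rule context_free_balanced context_free_letter; simp)+
  have eq: "balanced_zero =
      lang_conc {replicate n 0 @ replicate n 1 | n. True} (omega_power {[0::nat]})"
    by (auto simp: lang_conc_def omega_power_letter balanced_zero_def)
  show ?thesis
    unfolding eq by (rule lang_conc_omega_power_CFL[OF cf])
qed

text \<open>The positions of the letter 1 reveal both block lengths, so
  \<open>1^n 0^\<omega>\<close> with \<open>n > 0\<close> belongs to the quotient by
  \<open>0^m\<close> only for \<open>m = n\<close>.\<close>

lemma balanced_zero_not_RL: "balanced_zero \<notin> omega_RL \<Sigma>"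
proof (rule not_omega_RL_if_quots_distinct)
  have ones: "{i. ((replicate a 0 @ replicate b 1) \<frown> (\<lambda>_. 0::nat)) i = 1} = {a..<a + b}" for a b
    by (auto simp: conc_def nth_append)
  have no_eq: False
    if mn: "m < n" and eq: "omega_quot (replicate m 0) balanced_zero = omega_quot (replicate n 0) balanced_zero" for m n
  proof -
    have "replicate n 1 \<frown> (\<lambda>_. 0) \<in> omega_quot (replicate n 0) balanced_zero"
      by (auto simp: omega_quot_def balanced_zero_def)
    then obtain j where "(replicate m 0 @ replicate n 1) \<frown> (\<lambda>_. 0::nat) = (replicate j 0 @ replicate j 1) \<frown> (\<lambda>_. 0)"
      unfolding eq[symmetric] by (auto simp: omega_quot_def balanced_zero_def)
    then have "{m..<m + n} = {j..<j + j}" using ones by metis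
    \<comment> \<open>Only a nonempty interval determines its endpoints; \<open>m < n\<close>
      ensures \<open>n > 0\<close>.\<close>
    moreover have "m < m + n" using mn by simp
    ultimately have "m = j" "m + n = j + j"
      using atLeastLessThan_eq_iff[of m "m + n" j "j + j"] by (metis atLeastLessThan_empty_iff)+
    with mn show False by simp
  qed
  show "inj (\<lambda>n. omega_quot (replicate n 0) balanced_zero)"
    by (rule injI) (metis no_eq nat_neq_iff)
qed

text \<open>Recurrence of letter 1 would put \<open>1^k 0^\<omega>\<close> with \<open>k > 0\<close>
  into the language, and this word begins with 1.\<close>

lemma QBA_ND_gt_not_zero_only:
  assumes "0 \<le> lam" "(\<lambda>_. 0) \<in> L" "\<And>w. w \<in> L \<Longrightarrow> w 0 = 0"
  shows "L \<notin> QBA_ND_gt {0, 1} lam"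
proof
  assume "L \<in> QBA_ND_gt {0, 1} lam"
  then obtain k where "k > 0" "replicate k 1 \<frown> (\<lambda>_. 0) \<in> L"
    using QBA_ND_gt_prepend_power[OF _ assms(1,2), of _ 1] by blast
  with assms(3) show False by fastforce
qed

theorem theorem8:
  shows "(\<forall>lam::real. 0 \<le> lam \<and> lam < 1 \<longrightarrow>
            (\<exists>\<Sigma>. finite \<Sigma> \<and> \<not> omega_RL \<Sigma> \<subseteq> QBA_ND_gt \<Sigma> lam))
       \<and> (\<forall>lam::real. 0 \<le> lam \<and> lam < 1 \<longrightarrow>
            (\<exists>\<Sigma>. finite \<Sigma> \<and> \<not> omega_CFL \<Sigma> - omega_RL \<Sigma> \<subseteq> QBA_ND_gt \<Sigma> lam))
       \<and> (\<forall>lam::real. 0 < lam \<and> lam < 1 \<longrightarrow>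
            (\<exists>\<Sigma>. finite \<Sigma> \<and> \<not> QBA_ND_gt \<Sigma> lam \<subseteq> omega_RL \<Sigma>))
       \<and> (\<exists>\<Sigma>. finite \<Sigma> \<and> \<not> QBA_ND_eq1 \<Sigma> \<subseteq> omega_RL \<Sigma>)
       \<and> (\<exists>\<Sigma>. finite \<Sigma> \<and> \<not> QBA_ND_eq1 \<Sigma> \<subseteq> omega_CFL \<Sigma>)"
proof (intro conjI allI impI exI[of _ "{0, 1}"])
  fix lam :: real assume lam: "0 \<le> lam \<and> lam < 1"
  have "{\<lambda>_. 0} \<notin> QBA_ND_gt {0, 1} lam"
    using lam by (intro QBA_ND_gt_not_zero_only) auto
  then show "\<not> omega_RL {0, 1} \<subseteq> QBA_ND_gt {0, 1} lam"
    using zero_word_RL by blast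
next
  fix lam :: real assume lam: "0 \<le> lam \<and> lam < 1"
  have "balanced_zero \<notin> QBA_ND_gt {0, 1} lam"
  proof (rule QBA_ND_gt_not_zero_only)
    show "(\<lambda>_. 0) \<in> balanced_zero"
      unfolding balanced_zero_def by (auto intro!: exI[of _ 0])
    show "w 0 = 0" if "w \<in> balanced_zero" for w
      using that by (auto simp: balanced_zero_def conc_def nth_append)
  qed (use lam in simp)
  then show "\<not> omega_CFL {0, 1} - omega_RL {0, 1} \<subseteq> QBA_ND_gt {0, 1} lam"
    using balanced_zero_CFL balanced_zero_not_RL by blast
next
  fix lam :: real assume "0 < lam \<and> lam < 1"
  then show "\<not> QBA_ND_gt {0, 1} lam \<subseteq> omega_RL {0, 1}"
    using QBA_ND_gt_not_RL[of lam] by blast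
next
  \<comment> \<open>The same nonempty language without ultimately periodic words serves here and for
    the context-free class.\<close>
  show "\<not> QBA_ND_eq1 {0, 1} \<subseteq> omega_RL {0, 1}"
    by (rule QBA_ND_eq1_aperiodic) (metis omega_RL_imp_ultimately_periodic subsetD)
next
  show "\<not> QBA_ND_eq1 {0, 1} \<subseteq> omega_CFL {0, 1}"
    by (rule QBA_ND_eq1_aperiodic) (metis omega_CFL_imp_ultimately_periodic subsetD)
qed simp_all

end
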